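(* Let $I$ be the identity operator on a Hilbert space $\mathcal H$. The algebra $\mathbb CI$ of scalar matrices is completely hyperreflexive. However, $$1=\kappa_{\mathbb CI}<\kappa^c_{\mathbb CI}.$$
   Context: For a linear subspace $\mathcal S\subset\mathcal B(\mathcal H)$ and $x\in\mathcal H$, $P_{\mathcal Sx}$ is the orthogonal projection onto $\overline{\mathcal Sx}$, and $\beta_{\mathcal S}(T)=\sup_{\|x\|=1}\|P_{\mathcal Sx}^\perp Tx\|$. $\mathcal S$ is hyperreflexive if there is a constant $C$ with $\operatorname{dist}(T,\mathcal S)\le C\,\beta_{\mathcal S}(T)$ for all $T\in\mathcal B(\mathcal H)$; $\kappa_{\mathcal S}$ denotes the optimal such constant. A WOT-closed subspace $\mathcal S$ is completely hyperreflexive if $\mathcal S\,\bar\otimes\,\mathcal B(\mathcal K)\subset\mathcal B(\mathcal H\otimes\mathcal K)$ (the closure of the spatial tensor product in the weak operator topology, WOT) is hyperreflexive, where $\mathcal K$ is a separable (infinite-dimensional) Hilbert space; $\kappa^c_{\mathcal S}$ is the hyperreflexivity constant of $\mathcal S\,\bar\otimes\,\mathcal B(\mathcal K)$.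
   Formalization: The Hilbert space H is assumed to have dimension at least 2; for dim H ≤ 1 the algebra of scalars is all of B(H), both constants coincide, and the strict inequality fails. *)

theory Defs
  imports "HOL-Analysis.Analysis"
begin

text \<open>
  Complex Hilbert spaces of arbitrary dimension. The inner product is conjugate-linear in the
  first and linear in the second argument; positive definiteness is part of the axiom
  relating it to the norm.
\<close>

class complex_hilbert = banach +
  fixes scaleC :: "complex \<Rightarrow> 'a \<Rightarrow> 'a" (infixr \<open>*\<^sub>C\<close> 75)
    and cinner :: "'a \<Rightarrow> 'a \<Rightarrow> complex"
  assumes scaleC_add_right: "a *\<^sub>C (x + y) = a *\<^sub>C x + a *\<^sub>C y"
    and scaleC_add_left: "(a + b) *\<^sub>C x = a *\<^sub>C x + b *\<^sub>C x"
    and scaleC_scaleC: "a *\<^sub>C b *\<^sub>C x = (a * b) *\<^sub>C x"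
    and scaleR_scaleC: "r *\<^sub>R x = complex_of_real r *\<^sub>C x"
    and cinner_commute: "cinner x y = cnj (cinner y x)"
    and cinner_add_right: "cinner x (y + z) = cinner x y + cinner x z"
    and cinner_scaleC_right: "cinner x (a *\<^sub>C y) = a * cinner x y"
    and cinner_norm: "cinner x x = complex_of_real ((norm x)\<^sup>2)"

lemma scaleC_one: "1 *\<^sub>C x = (x :: 'a::complex_hilbert)"
  using scaleR_scaleC[of 1 x] by simp

interpretation complex_space: vector_space "scaleC :: complex \<Rightarrow> 'a \<Rightarrow> 'a::complex_hilbert"
  by unfold_locales (simp_all add: scaleC_add_right scaleC_add_left scaleC_scaleC scaleC_one)

lemma norm_scaleC: "norm (a *\<^sub>C x) = cmod a * norm (x :: 'a::complex_hilbert)"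
proof -
  have "cinner (a *\<^sub>C x) (a *\<^sub>C x) = a * cnj a * cinner x x"
    using cinner_commute[of "a *\<^sub>C x" x] cinner_commute[of x x]
    by (simp add: cinner_scaleC_right)
  then have "complex_of_real ((norm (a *\<^sub>C x))\<^sup>2) = complex_of_real ((cmod a * norm x)\<^sup>2)"
    by (simp add: cinner_norm complex_norm_square[symmetric] power_mult_distrib del: of_real_power)
  then have "(norm (a *\<^sub>C x))\<^sup>2 = (cmod a * norm x)\<^sup>2"
    by (simp only: of_real_eq_iff)
  then show ?thesis
    by (simp add: power2_eq_iff_nonneg)
qed

lemma bounded_linear_scaleC: "bounded_linear (\<lambda>x :: 'a::complex_hilbert. a *\<^sub>C x)"
proof (rule bounded_linear_intro)
  show "a *\<^sub>C (x + y) = a *\<^sub>C x + a *\<^sub>C y" for x y :: 'a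
    by (rule scaleC_add_right)
  show "a *\<^sub>C (r *\<^sub>R x) = r *\<^sub>R (a *\<^sub>C x)" for r and x :: 'a
    by (simp add: scaleR_scaleC scaleC_scaleC mult.commute)
  show "norm (a *\<^sub>C x) \<le> norm x * cmod a" for x :: 'a
    by (simp add: norm_scaleC mult.commute)
qed

definition separable_infinite_dim :: "'a::complex_hilbert itself \<Rightarrow> bool" where
  "separable_infinite_dim _ \<longleftrightarrow>
     separable_space (euclidean :: 'a topology) \<and>
     \<not> (\<exists>B :: 'a set. finite B \<and> complex_space.span B = UNIV)"

text \<open>
  The library type of bounded operators consists of the real-linear ones; \<open>B(H)\<close> is the
  subset of complex-linear ones. The norm is the operator norm.
\<close>

definition bounded_ops :: "('a::complex_hilbert \<Rightarrow>\<^sub>L 'a) set" where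
  "bounded_ops = {T. \<forall>c x. blinfun_apply T (c *\<^sub>C x) = c *\<^sub>C blinfun_apply T x}"

definition op_scaleC :: "complex \<Rightarrow> ('a::complex_hilbert \<Rightarrow>\<^sub>L 'a) \<Rightarrow> ('a \<Rightarrow>\<^sub>L 'a)" where
  "op_scaleC c T = Blinfun (\<lambda>x. c *\<^sub>C T x)"

lemma op_scaleC_apply: "op_scaleC c T x = c *\<^sub>C T x"
  unfolding op_scaleC_def
  by (subst bounded_linear_Blinfun_apply)
    (auto intro: bounded_linear_compose[OF bounded_linear_scaleC] blinfun.bounded_linear_right)

interpretation op_space: vector_space
  "op_scaleC :: complex \<Rightarrow> ('a::complex_hilbert \<Rightarrow>\<^sub>L 'a) \<Rightarrow> _"
  by unfold_locales
    (auto intro!: blinfun_eqI simp: op_scaleC_apply blinfun.add_left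
      scaleC_add_right scaleC_add_left scaleC_scaleC scaleC_one)

definition op_subspace :: "('a::complex_hilbert \<Rightarrow>\<^sub>L 'a) set \<Rightarrow> bool" where
  "op_subspace S \<longleftrightarrow> S \<subseteq> bounded_ops \<and> op_space.subspace S"

definition weak_operator_topology :: "('a::complex_hilbert \<Rightarrow>\<^sub>L 'a) topology" where
  "weak_operator_topology =
     pullback_topology UNIV (\<lambda>T (x, y). cinner x (blinfun_apply T y)) euclidean"

definition orth_proj :: "'a::complex_hilbert set \<Rightarrow> 'a \<Rightarrow> 'a" where
  "orth_proj M x = (THE y. y \<in> M \<and> (\<forall>z\<in>M. cinner z (x - y) = 0))"

definition beta :: "('a::complex_hilbert \<Rightarrow>\<^sub>L 'a) set \<Rightarrow> ('a \<Rightarrow>\<^sub>L 'a) \<Rightarrow> real" where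
  "beta S T =
     (SUP x\<in>{x. norm x = 1}. norm (T x - orth_proj (closure ((\<lambda>A. blinfun_apply A x) ` S)) (T x)))"

definition hyperreflexive_with :: "('a::complex_hilbert \<Rightarrow>\<^sub>L 'a) set \<Rightarrow> real \<Rightarrow> bool" where
  "hyperreflexive_with S C \<longleftrightarrow> (\<forall>T\<in>bounded_ops. infdist T S \<le> C * beta S T)"

definition hyperreflexive :: "('a::complex_hilbert \<Rightarrow>\<^sub>L 'a) set \<Rightarrow> bool" where
  "hyperreflexive S \<longleftrightarrow> (\<exists>C. hyperreflexive_with S C)"

text \<open>
  Meaningful for hyperreflexive \<open>S\<close> only. The sign condition matters only if \<open>S = B(H)\<close>,
  when every real number is an admissible constant.
\<close>

definition kappa :: "('a::complex_hilbert \<Rightarrow>\<^sub>L 'a) set \<Rightarrow> real" where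
  "kappa S = Inf {C. 0 \<le> C \<and> hyperreflexive_with S C}"

text \<open>
  The Hilbert space tensor product is determined up to a unique unitary by the following
  properties of \<open>(x, y) \<mapsto> x \<otimes> y\<close>; all notions below take such a map as parameter.
\<close>

definition hilbert_tensor ::
    "('h::complex_hilbert \<Rightarrow> 'k::complex_hilbert \<Rightarrow> 'l::complex_hilbert) \<Rightarrow> bool" where
  "hilbert_tensor tens \<longleftrightarrow>
     (\<forall>x x' y. tens (x + x') y = tens x y + tens x' y) \<and>
     (\<forall>x y y'. tens x (y + y') = tens x y + tens x y') \<and>
     (\<forall>c x y. tens (c *\<^sub>C x) y = c *\<^sub>C tens x y) \<and>
     (\<forall>c x y. tens x (c *\<^sub>C y) = c *\<^sub>C tens x y) \<and>
     (\<forall>x x' y y'. cinner (tens x y) (tens x' y') = cinner x x' * cinner y y') \<and>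
     closure (complex_space.span {tens x y | x y. True}) = UNIV"

definition elementary_op_tensors ::
    "('h::complex_hilbert \<Rightarrow> 'k::complex_hilbert \<Rightarrow> 'l::complex_hilbert) \<Rightarrow>
     ('h \<Rightarrow>\<^sub>L 'h) set \<Rightarrow> ('k \<Rightarrow>\<^sub>L 'k) set \<Rightarrow> ('l \<Rightarrow>\<^sub>L 'l) set" where
  "elementary_op_tensors tens S R =
     {X \<in> bounded_ops. \<exists>A\<in>S. \<exists>B\<in>R. \<forall>x y.
        blinfun_apply X (tens x y) = tens (blinfun_apply A x) (blinfun_apply B y)}"

definition spatial_tensor ::
    "('h::complex_hilbert \<Rightarrow> 'k::complex_hilbert \<Rightarrow> 'l::complex_hilbert) \<Rightarrow>
     ('h \<Rightarrow>\<^sub>L 'h) set \<Rightarrow> ('k \<Rightarrow>\<^sub>L 'k) set \<Rightarrow> ('l \<Rightarrow>\<^sub>L 'l) set" where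
  "spatial_tensor tens S R = closure (op_space.span (elementary_op_tensors tens S R))"

definition wot_tensor ::
    "('h::complex_hilbert \<Rightarrow> 'k::complex_hilbert \<Rightarrow> 'l::complex_hilbert) \<Rightarrow>
     ('h \<Rightarrow>\<^sub>L 'h) set \<Rightarrow> ('k \<Rightarrow>\<^sub>L 'k) set \<Rightarrow> ('l \<Rightarrow>\<^sub>L 'l) set" where
  "wot_tensor tens S R = weak_operator_topology closure_of (spatial_tensor tens S R)"

definition completely_hyperreflexive ::
    "('h::complex_hilbert \<Rightarrow> 'k::complex_hilbert \<Rightarrow> 'l::complex_hilbert) \<Rightarrow>
     ('h \<Rightarrow>\<^sub>L 'h) set \<Rightarrow> bool" where
  "completely_hyperreflexive tens S \<longleftrightarrow>
     op_subspace S \<and> closedin weak_operator_topology S \<and>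
     hyperreflexive (wot_tensor tens S bounded_ops)"

definition kappa_c ::
    "('h::complex_hilbert \<Rightarrow> 'k::complex_hilbert \<Rightarrow> 'l::complex_hilbert) \<Rightarrow>
     ('h \<Rightarrow>\<^sub>L 'h) set \<Rightarrow> real" where
  "kappa_c tens S = kappa (wot_tensor tens S bounded_ops)"

definition scalar_ops :: "('a::complex_hilbert \<Rightarrow>\<^sub>L 'a) set" where
  "scalar_ops = {op_scaleC c id_blinfun | c. True}"

end

theory Submission
  imports Defs
begin

text \<open>
  The number \<open>\<beta>\<^sub>S(T)\<close> is the supremum of \<open>|\<langle>u, T v\<rangle>|\<close> over unit vectors with \<open>u\<close> orthogonal to \<open>S v\<close>.
  For \<open>S = \<complex>I\<close> it equals the distance of \<open>T\<close> to the scalars (Stampfli), so the constant is 1.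

  The WOT closure of \<open>\<complex>I \<otimes> B(K)\<close> is \<open>I \<otimes> B(K)\<close>, which commutes with the sign changes and exchanges of
  an orthonormal system of \<open>H\<close>. Conjugation by such a symmetry moves \<open>T\<close> by at most \<open>2\<beta>(T)\<close>; averaging
  over the sign changes and then comparing the diagonal entries with a single one shows that \<open>T\<close> is
  within \<open>4\<beta>(T)\<close> of \<open>I \<otimes> B\<close>, where \<open>B\<close> is a diagonal entry of \<open>T\<close>.

  For the strict inequality, a partial isometry \<open>W\<close> of rank two lies at distance 1 from \<open>I \<otimes> B(K)\<close>
  although \<open>\<beta>(W) < 1\<close>.
\<close>

section \<open>Inner products and orthogonal projections\<close>

text \<open>Subtracting a member of \<open>S\<close> from \<open>T\<close> does not change
  \<open>cinner u (T v)\<close> when \<open>u\<close> is orthogonal to \<open>S v\<close>. So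
  \<beta> never exceeds the distance, and the work lies in the reverse estimates. For the scalars
  the obstacle is that the nearest scalar yields an extremal mixture of vectors, whereas \<beta>
  sees single vectors only. For \<open>I \<otimes> B(K)\<close> the dimension of H is arbitrary and
  no basis of H is used: two vectors of the algebraic tensor product live over a finite orthonormal
  system containing a fixed \<open>e\<close>. The approximant, built from the entry at
  \<open>e\<close>, is the same for all systems, so the bounds pass to the closure. The supremum
  defining \<beta>(W) runs over the unit sphere of an infinite-dimensional space and need not be
  attained. Hence a quantitative gap is proved, with the convenient but not optimal bound
  \<open>999 / 1000\<close>. Two orthonormal vectors of H are essential: on a line the scalars are
  all of B(H) and the smallest constant is 0.\<close>

lemma cinner_add_left: "cinner (x + y) z = cinner x z + cinner y (z :: 'a::complex_hilbert)"
  by (metis cinner_add_right cinner_commute complex_cnj_add)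

lemma cinner_scaleC_left: "cinner (a *\<^sub>C x) y = cnj a * cinner x (y :: 'a::complex_hilbert)"
  by (metis cinner_scaleC_right cinner_commute complex_cnj_mult)

lemma cinner_scaleR_right: "cinner x (r *\<^sub>R y) = of_real r * cinner x (y :: 'a::complex_hilbert)"
  by (simp add: scaleR_scaleC cinner_scaleC_right)

lemma cinner_scaleR_left: "cinner (r *\<^sub>R x) y = of_real r * cinner x (y :: 'a::complex_hilbert)"
  by (simp add: scaleR_scaleC cinner_scaleC_left)

lemma cinner_zero_right [simp]: "cinner x 0 = (0 :: complex)"
  using cinner_scaleR_right[of x 0 x] by simp

lemma cinner_zero_left [simp]: "cinner 0 x = (0 :: complex)"
  using cinner_scaleR_left[of 0 x x] by simp

lemma cinner_minus_right: "cinner x (- y) = - cinner x (y :: 'a::complex_hilbert)"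
  using cinner_scaleR_right[of x "-1" y] by simp

lemma cinner_minus_left: "cinner (- x) y = - cinner x (y :: 'a::complex_hilbert)"
  using cinner_scaleR_left[of "-1" x y] by simp

lemma cinner_diff_right: "cinner x (y - z) = cinner x y - cinner x (z :: 'a::complex_hilbert)"
  using cinner_add_right[of x y "- z"] by (simp add: cinner_minus_right)

lemma cinner_diff_left: "cinner (x - y) z = cinner x z - cinner y (z :: 'a::complex_hilbert)"
  using cinner_add_left[of x "- y" z] by (simp add: cinner_minus_left)

lemmas cinner_algebra = cinner_add_left cinner_add_right cinner_diff_left cinner_diff_right
  cinner_minus_left cinner_minus_right cinner_scaleC_left cinner_scaleC_right
  cinner_scaleR_left cinner_scaleR_right

lemma cinner_sum_right: "cinner x (\<Sum>i\<in>I. f i) = (\<Sum>i\<in>I. cinner x (f i :: 'a::complex_hilbert))"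
  by (induction I rule: infinite_finite_induct) (simp_all add: cinner_add_right)

lemma cinner_sum_left: "cinner (\<Sum>i\<in>I. f i) x = (\<Sum>i\<in>I. cinner (f i) (x :: 'a::complex_hilbert))"
  by (induction I rule: infinite_finite_induct) (simp_all add: cinner_add_left)

lemma norm_power2_cinner: "(norm x)\<^sup>2 = Re (cinner x (x :: 'a::complex_hilbert))"
  by (simp add: cinner_norm)

lemma norm_power2_eqI: "cinner x x = of_real r \<Longrightarrow> (norm (x :: 'a::complex_hilbert))\<^sup>2 = r"
  by (simp add: norm_power2_cinner)

lemma cinner_self_eq_0: "cinner x x = 0 \<longleftrightarrow> x = (0 :: 'a::complex_hilbert)"
  by (simp add: cinner_norm)

lemma norm_add_power2:
  "(norm (x + y))\<^sup>2 = (norm x)\<^sup>2 + (norm y)\<^sup>2 + 2 * Re (cinner x (y :: 'a::complex_hilbert))"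
  using cinner_commute[of y x] by (simp add: norm_power2_cinner cinner_algebra)

lemma norm_diff_power2:
  "(norm (x - y))\<^sup>2 = (norm x)\<^sup>2 + (norm y)\<^sup>2 - 2 * Re (cinner x (y :: 'a::complex_hilbert))"
  using cinner_commute[of y x] by (simp add: norm_power2_cinner cinner_algebra)

lemma parallelogram_law:
  "(norm (x + y))\<^sup>2 + (norm (x - y))\<^sup>2 = 2 * (norm x)\<^sup>2 + 2 * (norm (y :: 'a::complex_hilbert))\<^sup>2"
  by (simp add: norm_add_power2 norm_diff_power2)

text \<open>The factor is the conjugate phase of the inner product. After it is applied, the modulus
  appears as the real part in the formula for the norm of a difference.\<close>

lemma cinner_rotate:
  obtains c where "cmod c = 1" "cinner x (c *\<^sub>C y) = of_real (cmod (cinner x (y :: 'a::complex_hilbert)))"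
proof (cases "cinner x y = 0")
  case True
  then show ?thesis using that[of 1] by (simp add: scaleC_one)
next
  case False
  show ?thesis
  proof (rule that[of "cnj (cinner x y) / of_real (cmod (cinner x y))"])
    show "cmod (cnj (cinner x y) / of_real (cmod (cinner x y))) = 1"
      using False by (simp add: norm_divide)
    have "cnj (cinner x y) * cinner x y = of_real (cmod (cinner x y)) * of_real (cmod (cinner x y))"
      using complex_norm_square[of "cinner x y"] by (simp add: power2_eq_square mult.commute)
    then show "cinner x ((cnj (cinner x y) / of_real (cmod (cinner x y))) *\<^sub>C y)
        = of_real (cmod (cinner x y))"
      using False by (simp add: cinner_scaleC_right)
  qed
qed

lemma cinner_cauchy_schwarz: "cmod (cinner x y) \<le> norm x * norm (y :: 'a::complex_hilbert)"
proof (cases "x = 0 \<or> y = 0")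
  case False
  obtain c where c: "cmod c = 1" "cinner x (c *\<^sub>C y) = of_real (cmod (cinner x y))"
    by (rule cinner_rotate)
  have "0 \<le> (norm (norm y *\<^sub>R x - norm x *\<^sub>R (c *\<^sub>C y)))\<^sup>2" by simp
  also have "\<dots> = 2 * (norm x)\<^sup>2 * (norm y)\<^sup>2 - 2 * (norm x * norm y * cmod (cinner x y))"
    by (simp add: norm_diff_power2 norm_scaleC c cinner_scaleR_left cinner_scaleR_right
        power_mult_distrib)
  finally have "norm x * norm y * cmod (cinner x y) \<le> norm x * norm y * (norm x * norm y)"
    by (simp add: power2_eq_square algebra_simps)
  then show ?thesis using False by simp
qed auto

lemma bounded_linear_cinner_right: "bounded_linear (\<lambda>y :: 'a::complex_hilbert. cinner x y)"
  by (rule bounded_linear_intro[where K = "norm x"])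
    (auto simp: cinner_algebra scaleR_conv_of_real mult.commute
      intro: order_trans[OF cinner_cauchy_schwarz])

lemma bounded_linear_cinner_left: "bounded_linear (\<lambda>x :: 'a::complex_hilbert. cinner x y)"
  by (rule bounded_linear_intro[where K = "norm y"])
    (auto simp: cinner_algebra scaleR_conv_of_real intro: order_trans[OF cinner_cauchy_schwarz])

lemmas tendsto_cinner_right = bounded_linear.tendsto[OF bounded_linear_cinner_right]
lemmas continuous_on_cinner_right = bounded_linear.continuous_on[OF bounded_linear_cinner_right]
lemmas continuous_on_cinner_left = bounded_linear.continuous_on[OF bounded_linear_cinner_left]

lemma cinner_eq_0_on_closure:
  assumes "\<And>z. z \<in> D \<Longrightarrow> cinner z x = 0" and "w \<in> closure D"
  shows "cinner w (x :: 'a::complex_hilbert) = 0"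
proof -
  have "closed {z. cinner z x = 0}"
    by (intro closed_Collect_eq continuous_on_cinner_left continuous_intros)
  then have "closure D \<subseteq> {z. cinner z x = 0}"
    using assms(1) by (intro closure_minimal) auto
  then show ?thesis using assms(2) by blast
qed

lemma cinner_ext_dense:
  assumes "closure D = UNIV" and "\<And>z. z \<in> D \<Longrightarrow> cinner z x = cinner z (y :: 'a::complex_hilbert)"
  shows "x = y"
proof -
  have "cinner (x - y) (x - y) = 0"
    by (rule cinner_eq_0_on_closure[of D]) (use assms in \<open>auto simp: cinner_diff_right\<close>)
  then show ?thesis by (simp add: cinner_self_eq_0)
qed

lemma cinner_ext: "(\<And>z. cinner z x = cinner z y) \<Longrightarrow> x = (y :: 'a::complex_hilbert)"
  by (rule cinner_ext_dense[of UNIV]) auto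

text \<open>Closedness carries the bound to every \<open>z\<close>, in particular to
  \<open>z = x\<close>.\<close>

lemma norm_le_dense:
  assumes "closure D = UNIV" and "\<And>z. z \<in> D \<Longrightarrow> cmod (cinner z x) \<le> c * norm z" and "0 \<le> c"
  shows "norm (x :: 'a::complex_hilbert) \<le> c"
proof -
  have "closed {z. cmod (cinner z x) \<le> c * norm z}"
    by (intro closed_Collect_le continuous_on_cinner_left continuous_intros)
  then have "closure D \<subseteq> {z. cmod (cinner z x) \<le> c * norm z}"
    using assms(2) by (intro closure_minimal) auto
  then have "cmod (cinner x x) \<le> c * norm x" using assms(1) by auto
  then have "norm x * norm x \<le> c * norm x" by (simp add: cinner_norm norm_power power2_eq_square norm_mult)
  then show ?thesis using assms(3) by (cases "x = 0") auto
qed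

lemma norm_le_cinner:
  assumes "\<And>z. cmod (cinner z x) \<le> c * norm z" and "0 \<le> c"
  shows "norm (x :: 'a::complex_hilbert) \<le> c"
  by (rule norm_le_dense[of UNIV]) (use assms in auto)

section \<open>Orthogonal projection onto a closed subspace\<close>

lemma orthogonal_projection_exists:
  fixes M :: "'a::complex_hilbert set"
  assumes sub: "complex_space.subspace M" and cl: "closed M"
  shows "\<exists>y\<in>M. \<forall>z\<in>M. cinner z (x - y) = 0"
proof -
  define d where "d = infdist x M"
  have ne: "M \<noteq> {}" using complex_space.subspace_0[OF sub] by blast
  have dle: "d \<le> norm (x - y)" if "y \<in> M" for y
    using infdist_le[OF that, of x] by (simp add: d_def dist_norm)
  have d0: "0 \<le> d" by (simp add: d_def infdist_nonneg)
  have "\<exists>y\<in>M. (norm (x - y))\<^sup>2 < d\<^sup>2 + inverse (Suc n)" for n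
  proof -
    have "d < sqrt (d\<^sup>2 + inverse (Suc n))" using d0 by (intro real_less_rsqrt) simp
    moreover have "bdd_below (dist x ` M)" by (rule bdd_belowI2[of _ 0]) simp
    ultimately obtain y where y: "y \<in> M" "dist x y < sqrt (d\<^sup>2 + inverse (Suc n))"
      using ne by (auto simp: d_def infdist_notempty cINF_less_iff)
    have "(norm (x - y))\<^sup>2 < (sqrt (d\<^sup>2 + inverse (Suc n)))\<^sup>2"
      using y(2) by (intro power_strict_mono) (auto simp: dist_norm)
    also have "\<dots> = d\<^sup>2 + inverse (Suc n)" by (intro real_sqrt_pow2) simp
    finally show ?thesis using y(1) by blast
  qed
  then obtain Y where Y: "\<And>n. Y n \<in> M" "\<And>n. (norm (x - Y n))\<^sup>2 < d\<^sup>2 + inverse (Suc n)"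
    by metis
  \<comment> \<open>The midpoint of \<open>Y m\<close> and \<open>Y n\<close> also lies in
    \<open>M\<close>, so its distance from \<open>x\<close> is at least \<open>d\<close>; the
    parallelogram law turns this into closeness of the two points.\<close>
  have diff: "(norm (Y m - Y n))\<^sup>2 \<le> 2 * inverse (Suc m) + 2 * inverse (Suc n)" for m n
  proof -
    have "(1/2) *\<^sub>R (Y m + Y n) \<in> M"
      unfolding scaleR_scaleC
      by (intro complex_space.subspace_scale complex_space.subspace_add sub Y)
    then have "d\<^sup>2 \<le> (norm (x - (1/2) *\<^sub>R (Y m + Y n)))\<^sup>2"
      using dle d0 by (intro power_mono) auto
    also have "\<dots> = (norm ((1/2) *\<^sub>R ((x - Y m) + (x - Y n))))\<^sup>2"
    proof -
      have "(x - Y m) + (x - Y n) = (x + x) - (Y m + Y n)" by simp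
      then show ?thesis by (simp only: scaleR_diff_right scaleR_half_double)
    qed
    also have "\<dots> = (norm ((x - Y m) + (x - Y n)))\<^sup>2 / 4"
      by (simp only: norm_scaleR power_mult_distrib) (simp add: power2_eq_square)
    finally have "4 * d\<^sup>2 \<le> (norm ((x - Y m) + (x - Y n)))\<^sup>2" by simp
    moreover have "(norm ((x - Y m) - (x - Y n)))\<^sup>2 = (norm (Y m - Y n))\<^sup>2"
      by (simp add: norm_minus_commute)
    ultimately show ?thesis
      using parallelogram_law[of "x - Y m" "x - Y n"] Y(2)[of m] Y(2)[of n] by linarith
  qed
  have "Cauchy Y"
  proof (rule metric_CauchyI)
    fix e :: real assume "0 < e"
    then obtain N where N: "inverse (Suc N) < e\<^sup>2 / 4"
      using reals_Archimedean[of "e\<^sup>2/4"] by auto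
    have "dist (Y m) (Y n) < e" if "m \<ge> N" "n \<ge> N" for m n
    proof -
      have "inverse (Suc m) \<le> inverse (real (Suc N))" "inverse (Suc n) \<le> inverse (real (Suc N))"
        using that by (auto simp: field_simps)
      then have "(norm (Y m - Y n))\<^sup>2 < e\<^sup>2" using diff[of m n] N by linarith
      then show ?thesis using \<open>0 < e\<close> by (simp add: dist_norm power2_less_imp_less)
    qed
    then show "\<exists>M. \<forall>m\<ge>M. \<forall>n\<ge>M. dist (Y m) (Y n) < e" by blast
  qed
  then obtain y where lim: "Y \<longlonglongrightarrow> y" using Cauchy_convergent convergent_def by blast
  have yM: "y \<in> M" using closed_sequentially[OF cl] Y(1) lim by blast
  have "(\<lambda>n. (norm (x - Y n))\<^sup>2) \<longlonglongrightarrow> (norm (x - y))\<^sup>2"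
    by (intro tendsto_intros lim)
  moreover have "(\<lambda>n. d\<^sup>2 + inverse (real (Suc n))) \<longlonglongrightarrow> d\<^sup>2 + 0"
    by (intro tendsto_intros LIMSEQ_inverse_real_of_nat)
  ultimately have near: "(norm (x - y))\<^sup>2 \<le> d\<^sup>2"
    using Y(2) by (intro LIMSEQ_le[of _ _ "\<lambda>n. d\<^sup>2 + inverse (real (Suc n))"]) (auto intro: less_imp_le)
  have "cinner z (x - y) = 0" if z: "z \<in> M" for z
  proof (cases "z = 0")
    case False
    \<comment> \<open>\<open>c *\<^sub>C z\<close> is the component of \<open>x - y\<close> along
      \<open>z\<close>. Adding it to \<open>y\<close> would lower the squared distance by
      \<open>(cmod c * norm z)\<^sup>2\<close>, which minimality forbids unless
      \<open>c = 0\<close>.\<close>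
    define c where "c = cinner z (x - y) / of_real ((norm z)\<^sup>2)"
    have "y + c *\<^sub>C z \<in> M"
      by (intro complex_space.subspace_scale complex_space.subspace_add sub z yM)
    then have "d\<^sup>2 \<le> (norm ((x - y) - c *\<^sub>C z))\<^sup>2"
      using dle[of "y + c *\<^sub>C z"] d0 by (intro power_mono) (auto simp: algebra_simps)
    also have "\<dots> = (norm (x - y))\<^sup>2 + (cmod c * norm z)\<^sup>2 - 2 * Re (c * cinner (x - y) z)"
      by (simp only: norm_diff_power2 norm_scaleC cinner_scaleC_right)
    also have "c * cinner (x - y) z = of_real ((cmod c * norm z)\<^sup>2)"
    proof -
      have "cinner (x - y) z = cnj c * of_real ((norm z)\<^sup>2)"
        using False cinner_commute[of "x - y" z] by (simp add: c_def)
      then show ?thesis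
        using complex_norm_square[of c] by (simp add: power_mult_distrib)
    qed
    finally have "(cmod c * norm z)\<^sup>2 \<le> 0" using near by (simp only: Re_complex_of_real)
    then have "c = 0" using False by simp
    then show ?thesis using False by (simp add: c_def)
  qed auto
  then show ?thesis using yM by blast
qed

text \<open>Existence and uniqueness make the description in \<open>orth_proj\<close> definite.
  Afterwards only membership and orthogonality of the residual are used.\<close>

lemma
  fixes M :: "'a::complex_hilbert set"
  assumes "complex_space.subspace M" and "closed M"
  shows orth_proj_in: "orth_proj M x \<in> M"
    and orth_proj_orthogonal: "z \<in> M \<Longrightarrow> cinner z (x - orth_proj M x) = 0"
proof -
  have "\<exists>!y. y \<in> M \<and> (\<forall>z\<in>M. cinner z (x - y) = 0)"
  proof (rule ex_ex1I)
    show "\<exists>y. y \<in> M \<and> (\<forall>z\<in>M. cinner z (x - y) = 0)"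
      using orthogonal_projection_exists[OF assms] by blast
    fix y y' assume y: "y \<in> M \<and> (\<forall>z\<in>M. cinner z (x - y) = 0)"
      "y' \<in> M \<and> (\<forall>z\<in>M. cinner z (x - y') = 0)"
    then have "y - y' \<in> M" using complex_space.subspace_diff[OF assms(1)] by blast
    with y have "cinner (y - y') ((x - y') - (x - y)) = 0"
      by (subst cinner_diff_right) simp
    then show "y = y'" by (simp add: cinner_self_eq_0)
  qed
  from theI'[OF this] show "orth_proj M x \<in> M" "z \<in> M \<Longrightarrow> cinner z (x - orth_proj M x) = 0"
    unfolding orth_proj_def by auto
qed

lemma norm_orth_proj_residual_le:
  fixes M :: "'a::complex_hilbert set"
  assumes "complex_space.subspace M" and "closed M"
  shows "norm (x - orth_proj M x) \<le> norm x"
proof -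
  have "cinner (orth_proj M x) (x - orth_proj M x) = 0"
    using assms orth_proj_in orth_proj_orthogonal by blast
  then have "(norm x)\<^sup>2 = (norm (x - orth_proj M x))\<^sup>2 + (norm (orth_proj M x))\<^sup>2"
    using norm_add_power2[of "orth_proj M x" "x - orth_proj M x"] by simp
  then have "(norm (x - orth_proj M x))\<^sup>2 \<le> (norm x)\<^sup>2" by simp
  then show ?thesis by (rule power2_le_imp_le) simp
qed

lemma closure_complex_subspace:
  fixes M :: "'a::complex_hilbert set"
  assumes sub: "complex_space.subspace M"
  shows "complex_space.subspace (closure M)"
proof (rule complex_space.subspaceI)
  show "0 \<in> closure M" using complex_space.subspace_0[OF sub] closure_subset by blast
next
  fix x y assume "x \<in> closure M" "y \<in> closure M"
  then obtain X Y where "\<forall>n. X n \<in> M" "X \<longlonglongrightarrow> x" "\<forall>n. Y n \<in> M" "Y \<longlonglongrightarrow> y"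
    unfolding closure_sequential by blast
  then have "(\<forall>n. X n + Y n \<in> M) \<and> (\<lambda>n. X n + Y n) \<longlonglongrightarrow> x + y"
    using complex_space.subspace_add[OF sub] by (auto intro: tendsto_add)
  then show "x + y \<in> closure M" unfolding closure_sequential by (rule exI[of _ "\<lambda>n. X n + Y n"])
next
  fix c x assume "x \<in> closure M"
  then obtain X where "\<forall>n. X n \<in> M" "X \<longlonglongrightarrow> x"
    unfolding closure_sequential by blast
  then have "(\<forall>n. c *\<^sub>C X n \<in> M) \<and> (\<lambda>n. c *\<^sub>C X n) \<longlonglongrightarrow> c *\<^sub>C x"
    using complex_space.subspace_scale[OF sub] bounded_linear.tendsto[OF bounded_linear_scaleC]
    by blast
  then show "c *\<^sub>C x \<in> closure M"
    unfolding closure_sequential by (rule exI[of _ "\<lambda>n. c *\<^sub>C X n"])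
qed

section \<open>The seminorm \<open>\<beta>\<close>\<close>

lemma orbit_closure_subspace:
  fixes S :: "('a::complex_hilbert \<Rightarrow>\<^sub>L 'a) set"
  assumes S: "op_space.subspace S"
  shows "complex_space.subspace (closure ((\<lambda>A. blinfun_apply A x) ` S))"
proof (rule closure_complex_subspace, rule complex_space.subspaceI)
  show "0 \<in> (\<lambda>A. blinfun_apply A x) ` S"
    using op_space.subspace_0[OF S] by (intro image_eqI[of _ _ 0]) auto
next
  fix y z assume "y \<in> (\<lambda>A. blinfun_apply A x) ` S" "z \<in> (\<lambda>A. blinfun_apply A x) ` S"
  then obtain A B where "A \<in> S" "B \<in> S" "y = A x" "z = B x" by blast
  then show "y + z \<in> (\<lambda>A. blinfun_apply A x) ` S"
    using op_space.subspace_add[OF S] by (intro image_eqI[of _ _ "A + B"]) (auto simp: blinfun.add_left)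
next
  fix c y assume "y \<in> (\<lambda>A. blinfun_apply A x) ` S"
  then obtain A where "A \<in> S" "y = A x" by blast
  then show "c *\<^sub>C y \<in> (\<lambda>A. blinfun_apply A x) ` S"
    using op_space.subspace_scale[OF S]
    by (intro image_eqI[of _ _ "op_scaleC c A"]) (auto simp: op_scaleC_apply)
qed

lemma beta_upper:
  fixes S :: "('a::complex_hilbert \<Rightarrow>\<^sub>L 'a) set" and T :: "'a \<Rightarrow>\<^sub>L 'a"
  assumes S: "op_space.subspace S" and "norm x = 1"
  shows "norm (T x - orth_proj (closure ((\<lambda>A. blinfun_apply A x) ` S)) (T x)) \<le> beta S T"
  unfolding beta_def
proof (rule cSUP_upper)
  show "bdd_above ((\<lambda>x. norm (T x - orth_proj (closure ((\<lambda>A. blinfun_apply A x) ` S)) (T x)))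
      ` {x. norm x = 1})"
  proof (rule bdd_aboveI2)
    fix y :: 'a assume "y \<in> {x. norm x = 1}"
    then show "norm (T y - orth_proj (closure ((\<lambda>A. blinfun_apply A y) ` S)) (T y)) \<le> norm T"
      using norm_orth_proj_residual_le[OF orbit_closure_subspace[OF S, of y] closed_closure, of "T y"]
        norm_blinfun[of T y] by simp
  qed
qed (use assms in auto)

lemma beta_nonneg:
  assumes "op_space.subspace S" and "norm (x :: 'a::complex_hilbert) = 1"
  shows "0 \<le> beta S (T :: 'a \<Rightarrow>\<^sub>L 'a)"
  using beta_upper[OF assms, of T] by (meson norm_ge_zero order_trans)

text \<open>A vector \<open>u\<close> orthogonal to \<open>S v\<close> only sees the residual of
  \<open>T v\<close>. With \<open>beta_le\<close> this describes \<beta> through coefficients, so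
  that later estimates of \<beta> need no projection.\<close>

lemma cinner_le_beta:
  fixes S :: "('a::complex_hilbert \<Rightarrow>\<^sub>L 'a) set" and T :: "'a \<Rightarrow>\<^sub>L 'a"
  assumes S: "op_space.subspace S" and orth: "\<And>A. A \<in> S \<Longrightarrow> cinner u (A v) = 0"
  shows "cmod (cinner u (T v)) \<le> beta S T * norm u * norm v"
proof (cases "v = 0")
  case False
  define x where "x = (1 / norm v) *\<^sub>R v"
  define M where "M = closure ((\<lambda>A. blinfun_apply A x) ` S)"
  have x: "norm x = 1" "v = norm v *\<^sub>R x" using False by (auto simp: x_def)
  have M: "complex_space.subspace M" "closed M"
    using orbit_closure_subspace[OF S] by (auto simp: M_def)
  have "cinner z u = 0" if "z \<in> (\<lambda>A. blinfun_apply A x) ` S" for z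
    using that orth cinner_commute[of z u]
    by (auto simp: x_def blinfun.scaleR_right cinner_scaleR_right)
  then have "cinner (orth_proj M (T x)) u = 0"
    using orth_proj_in[OF M] cinner_eq_0_on_closure unfolding M_def by blast
  then have "cinner u (T x) = cinner u (T x - orth_proj M (T x))"
    using cinner_commute[of u "orth_proj M (T x)"] by (simp add: cinner_diff_right)
  then have "cmod (cinner u (T x)) \<le> norm u * beta S T"
    using cinner_cauchy_schwarz[of u "T x - orth_proj M (T x)"] beta_upper[OF S x(1), of T]
    by (smt (verit) M_def mult_left_mono norm_ge_zero)
  then have "norm v * cmod (cinner u (T x)) \<le> norm v * (norm u * beta S T)"
    by (intro mult_left_mono) auto
  moreover have "cinner u (T v) = of_real (norm v) * cinner u (T x)"
    by (subst x(2)) (simp add: blinfun.scaleR_right cinner_scaleR_right)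
  ultimately show ?thesis by (simp add: norm_mult mult_ac)
qed auto

lemma beta_le:
  fixes S :: "('a::complex_hilbert \<Rightarrow>\<^sub>L 'a) set" and T :: "'a \<Rightarrow>\<^sub>L 'a"
  assumes S: "op_space.subspace S" and ne: "norm (x0 :: 'a) = 1" and "0 \<le> c"
    and le: "\<And>u v. norm u = 1 \<Longrightarrow> norm v = 1 \<Longrightarrow> (\<And>A. A \<in> S \<Longrightarrow> cinner u (A v) = 0)
      \<Longrightarrow> cmod (cinner u (T v)) \<le> c"
  shows "beta S T \<le> c"
  unfolding beta_def
proof (rule cSUP_least)
  show "{x :: 'a. norm x = 1} \<noteq> {}" using ne by auto
  fix x :: 'a assume "x \<in> {x. norm x = 1}"
  then have x: "norm x = 1" by simp
  define M where "M = closure ((\<lambda>A. blinfun_apply A x) ` S)"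
  define r where "r = T x - orth_proj M (T x)"
  have M: "complex_space.subspace M" "closed M"
    using orbit_closure_subspace[OF S] by (auto simp: M_def)
  have "norm r \<le> c"
  proof (cases "r = 0")
    case False
    \<comment> \<open>The normalised residual is the extremal choice: it is orthogonal to
      \<open>M\<close>, and its coefficient with \<open>T x\<close> is exactly
      \<open>norm r\<close>.\<close>
    define u where "u = (1 / norm r) *\<^sub>R r"
    have "cinner z r = 0" if "z \<in> M" for z
      using orth_proj_orthogonal[OF M that] by (simp add: r_def)
    then have zero: "cinner u z = 0" if "z \<in> M" for z
      using cinner_commute[of r z] that by (simp add: u_def cinner_scaleR_left)
    have "A x \<in> M" if "A \<in> S" for A
      using that closure_subset[of "(\<lambda>A. blinfun_apply A x) ` S"] by (auto simp: M_def)
    then have "cmod (cinner u (T x)) \<le> c"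
      using le[of u x] zero x False by (simp add: u_def)
    moreover have "cinner u (T x) = cinner u r"
      using zero[OF orth_proj_in[OF M]] by (simp add: r_def cinner_diff_right)
    moreover have "cinner u r = of_real (norm r)"
      using False by (simp add: u_def cinner_scaleR_left cinner_norm power2_eq_square)
    ultimately show ?thesis by simp
  qed (use \<open>0 \<le> c\<close> in auto)
  then show "norm (T x - orth_proj (closure ((\<lambda>A. blinfun_apply A x) ` S)) (T x)) \<le> c"
    by (simp add: r_def M_def)
qed

lemma beta_le_infdist:
  fixes S :: "('a::complex_hilbert \<Rightarrow>\<^sub>L 'a) set" and T :: "'a \<Rightarrow>\<^sub>L 'a"
  assumes S: "op_space.subspace S" and ne: "norm (x0 :: 'a) = 1"
  shows "beta S T \<le> infdist T S"
proof -
  have "beta S T \<le> dist T A" if A: "A \<in> S" for A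
  proof (rule beta_le[OF S ne])
    fix u v assume u: "norm u = 1" "norm v = 1" and "\<And>A. A \<in> S \<Longrightarrow> cinner u (A v) = 0"
    then have "cinner u (T v) = cinner u ((T - A) v)"
      using A by (simp add: blinfun.diff_left cinner_diff_right)
    also have "cmod \<dots> \<le> norm (T - A)"
      using cinner_cauchy_schwarz[of u "(T - A) v"] norm_blinfun[of "T - A" v] u by simp
    finally show "cmod (cinner u (T v)) \<le> dist T A" by (simp add: dist_norm)
  qed simp
  moreover have "S \<noteq> {}" using op_space.subspace_0[OF S] by blast
  ultimately show ?thesis by (auto simp: infdist_notempty intro: cINF_greatest)
qed

section \<open>The distance to the scalars\<close>

lemma bounded_ops_scaleC: "T \<in> bounded_ops \<Longrightarrow> blinfun_apply T (c *\<^sub>C x) = c *\<^sub>C blinfun_apply T x"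
  by (simp add: bounded_ops_def)

lemma bounded_ops_diff: "S \<in> bounded_ops \<Longrightarrow> T \<in> bounded_ops \<Longrightarrow> S - T \<in> bounded_ops"
  by (simp add: bounded_ops_def blinfun.diff_left complex_space.scale_right_diff_distrib)

lemma scalar_op_apply: "blinfun_apply (op_scaleC c id_blinfun) x = c *\<^sub>C x"
  by (simp add: op_scaleC_apply)

lemma scalar_op_bounded_ops: "op_scaleC c id_blinfun \<in> bounded_ops"
  by (simp add: bounded_ops_def scalar_op_apply scaleC_scaleC mult.commute)

lemma bounded_linear_scalar_op:
  "bounded_linear (\<lambda>c. op_scaleC c id_blinfun :: 'a::complex_hilbert \<Rightarrow>\<^sub>L 'a)"
proof (rule bounded_linear_intro)
  show "norm (op_scaleC c id_blinfun :: 'a \<Rightarrow>\<^sub>L 'a) \<le> norm c * 1" for c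
    by (rule norm_blinfun_bound) (auto simp: scalar_op_apply norm_scaleC)
qed (auto intro!: blinfun_eqI simp: scalar_op_apply blinfun.add_left blinfun.scaleR_left
      scaleC_add_left scaleR_scaleC scaleC_scaleC scaleR_conv_of_real)

lemma norm_blinfun_le_unit:
  fixes A :: "'a::real_normed_vector \<Rightarrow>\<^sub>L 'b::real_normed_vector"
  assumes "0 \<le> b" and "\<And>x. norm x = 1 \<Longrightarrow> norm (A x) \<le> b"
  shows "norm A \<le> b"
proof (rule norm_blinfun_bound[OF assms(1)])
  fix x :: 'a
  show "norm (A x) \<le> b * norm x"
  proof (cases "x = 0")
    case False
    then have "norm (A ((1 / norm x) *\<^sub>R x)) \<le> b" by (intro assms(2)) simp
    then show ?thesis using False by (simp add: blinfun.scaleR_right pos_divide_le_eq)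
  qed simp
qed

section \<open>Rotating pairs of vectors to annihilate a quadratic form\<close>

lemma cinner_rotation:
  fixes x x' y y' :: "'a::complex_hilbert"
  assumes "c\<^sup>2 + s\<^sup>2 = (1 :: real)"
  shows "cinner (c *\<^sub>R x + s *\<^sub>R y) (c *\<^sub>R x' + s *\<^sub>R y') + cinner (c *\<^sub>R y - s *\<^sub>R x) (c *\<^sub>R y' - s *\<^sub>R x')
    = cinner x x' + cinner y y'"
proof -
  have "cinner (c *\<^sub>R x + s *\<^sub>R y) (c *\<^sub>R x' + s *\<^sub>R y') + cinner (c *\<^sub>R y - s *\<^sub>R x) (c *\<^sub>R y' - s *\<^sub>R x')
    = of_real (c\<^sup>2 + s\<^sup>2) * (cinner x x' + cinner y y')"
    by (simp add: cinner_algebra algebra_simps power2_eq_square)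
  then show ?thesis by (simp only: assms) simp
qed

lemma norm_rotation:
  fixes x y :: "'a::complex_hilbert"
  assumes "c\<^sup>2 + s\<^sup>2 = (1 :: real)"
  shows "(norm (c *\<^sub>R x + s *\<^sub>R y))\<^sup>2 + (norm (c *\<^sub>R y - s *\<^sub>R x))\<^sup>2 = (norm x)\<^sup>2 + (norm y)\<^sup>2"
  using arg_cong[OF cinner_rotation[OF assms, of x y x y], of Re]
  by (simp add: norm_power2_cinner del: of_real_power)

lemma quadratic_form_rotation:
  fixes A :: "'a::complex_hilbert \<Rightarrow>\<^sub>L 'a"
  shows "cinner (c *\<^sub>R v + s *\<^sub>R w) (A (c *\<^sub>R v + s *\<^sub>R w))
    = of_real (c\<^sup>2) * cinner v (A v) + of_real (s\<^sup>2) * cinner w (A w)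
      + of_real (c * s) * (cinner v (A w) + cinner w (A v))"
  by (simp add: cinner_algebra blinfun.add_right blinfun.scaleR_right algebra_simps power2_eq_square)

text \<open>A quarter turn leads from \<open>v\<close> to \<open>w\<close> and the form changes sign
  on the way, so the intermediate value theorem supplies the angle. The functional
  \<open>\<phi>\<close> will be \<open>Re\<close> or \<open>Im\<close>: one real parameter, one real
  equation.\<close>

lemma quadratic_form_rotation_zero:
  fixes A :: "'a::complex_hilbert \<Rightarrow>\<^sub>L 'a" and \<phi> :: "complex \<Rightarrow> real"
  assumes \<phi>: "bounded_linear \<phi>" and "\<phi> (cinner v (A v)) \<ge> 0" "\<phi> (cinner w (A w)) \<le> 0"
  shows "\<exists>c s. c\<^sup>2 + s\<^sup>2 = 1 \<and> \<phi> (cinner (c *\<^sub>R v + s *\<^sub>R w) (A (c *\<^sub>R v + s *\<^sub>R w))) = 0"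
proof -
  define g where "g t = \<phi> (cinner (cos t *\<^sub>R v + sin t *\<^sub>R w) (A (cos t *\<^sub>R v + sin t *\<^sub>R w)))" for t
  have "continuous_on {0..pi/2} g"
    unfolding g_def quadratic_form_rotation
    by (intro bounded_linear.continuous_on[OF \<phi>] continuous_intros)
  moreover have "g (pi/2) \<le> 0" "0 \<le> g 0" using assms by (auto simp: g_def)
  ultimately obtain t where "g t = 0" using IVT2'[of g "pi/2" 0 0] by auto
  then show ?thesis
    by (intro exI[of _ "cos t"] exI[of _ "sin t"]) (auto simp: g_def)
qed

lemma phase_making_imaginary: "\<exists>\<omega>. cmod \<omega> = 1 \<and> Re (\<omega> * z) = 0"
proof (cases "z = 0")
  case False
  have "Re (\<i> * cnj z / of_real (cmod z) * z) = Re (\<i> * (z * cnj z)) / cmod z"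
    by (simp add: mult_ac Re_divide_of_real)
  also have "\<dots> = 0" by (simp add: complex_norm_square[symmetric])
  finally show ?thesis
    using False by (intro exI[of _ "\<i> * cnj z / of_real (cmod z)"]) (simp add: norm_mult norm_divide)
qed (auto intro: exI[of _ 1])

lemma sum_split_two:
  assumes "finite I" "i \<in> I" "j \<in> I" "i \<noteq> j"
  shows "sum f I = f i + f j + sum f (I - {i, j})"
proof -
  have "sum f I = f i + sum f (I - {i})" using assms by (simp add: sum.remove)
  also have "sum f (I - {i}) = f j + sum f (I - {i} - {j})" using assms by (intro sum.remove) auto
  finally show ?thesis by (simp add: add.assoc Diff_insert2[symmetric] insert_commute)
qed

lemma sum_zero_signs:
  fixes f :: "'i \<Rightarrow> real"
  assumes "finite I" "sum f I = 0" "k \<in> I" "f k \<noteq> 0"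
  obtains i j where "i \<in> I" "j \<in> I" "f i > 0" "f j < 0"
proof -
  have "\<exists>i\<in>I. f i > 0"
  proof (rule ccontr)
    assume "\<not> ?thesis"
    then have "\<forall>i\<in>I. - f i \<ge> 0" by (auto simp: not_less)
    then have "\<forall>i\<in>I. - f i = 0"
      using sum_nonneg_eq_0_iff[of I "\<lambda>i. - f i"] assms by (simp add: sum_negf)
    then show False using assms by auto
  qed
  moreover have "\<exists>j\<in>I. f j < 0"
  proof (rule ccontr)
    assume "\<not> ?thesis"
    then have "\<forall>i\<in>I. f i \<ge> 0" by (auto simp: not_less)
    then have "\<forall>i\<in>I. f i = 0" using sum_nonneg_eq_0_iff[of I f] assms by simp
    then show False using assms by auto
  qed
  ultimately show ?thesis using that by blast
qed

text \<open>Each induction step disposes of one index. Two vectors with imaginary parts of opposite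
  sign are rotated so that one gets the value 0 and is estimated by \<open>b\<close>; the other
  inherits the sum of both values, so the total stays 0 for the remaining family.\<close>

lemma sum_norm_bound_imaginary_diagonal:
  fixes A :: "'a::complex_hilbert \<Rightarrow>\<^sub>L 'a" and v :: "'i \<Rightarrow> 'a"
  assumes A: "A \<in> bounded_ops" and b: "\<And>x. cinner x (A x) = 0 \<Longrightarrow> (norm (A x))\<^sup>2 \<le> b\<^sup>2 * (norm x)\<^sup>2"
    and "finite I" and "\<And>i. i \<in> I \<Longrightarrow> Re (cinner (v i) (A (v i))) = 0"
    and "(\<Sum>i\<in>I. Im (cinner (v i) (A (v i)))) = 0"
  shows "(\<Sum>i\<in>I. (norm (A (v i)))\<^sup>2) \<le> b\<^sup>2 * (\<Sum>i\<in>I. (norm (v i))\<^sup>2)"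
  using assms(3-)
proof (induction "card I" arbitrary: I v rule: less_induct)
  case less
  show ?case
  proof (cases "\<forall>i\<in>I. Im (cinner (v i) (A (v i))) = 0")
    case True
    then have "cinner (v i) (A (v i)) = 0" if "i \<in> I" for i
      using less.prems that by (simp add: complex_eq_iff)
    then show ?thesis by (auto simp: sum_distrib_left intro!: sum_mono b)
  next
    case False
    then obtain i j where ij: "i \<in> I" "j \<in> I" "Im (cinner (v i) (A (v i))) > 0"
        "Im (cinner (v j) (A (v j))) < 0"
      using sum_zero_signs[OF less.prems(1) less.prems(3)] by blast
    then have "i \<noteq> j" by auto
    \<comment> \<open>Rotating \<open>v i\<close> and \<open>v j\<close> as they are could create a
      real part through the cross terms. The phase makes the sum of the cross terms imaginary, so
      that cancelling the imaginary part cancels the whole value.\<close>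
    obtain \<omega> where \<omega>: "cmod \<omega> = 1"
        "Re (\<omega> * (cinner (v i) (A (v j)) + cnj (cinner (v j) (A (v i))))) = 0"
      using phase_making_imaginary by blast
    define w where "w = \<omega> *\<^sub>C v j"
    have w: "A w = \<omega> *\<^sub>C A (v j)" "norm w = norm (v j)" "norm (A w) = norm (A (v j))"
      using A \<omega> by (auto simp: w_def bounded_ops_scaleC norm_scaleC)
    have "cnj \<omega> * \<omega> = 1"
      using complex_norm_square[of \<omega>] \<omega>(1) by (simp add: mult.commute)
    then have qw: "cinner w (A w) = cinner (v j) (A (v j))"
      by (simp add: w(1)) (simp add: w_def cinner_scaleC_left cinner_scaleC_right mult.commute[of \<omega>] flip: mult.assoc)
    have cross: "Re (cinner (v i) (A w) + cinner w (A (v i))) = 0"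
      using \<omega>(2) by (simp add: w(1)) (simp add: w_def cinner_scaleC_left cinner_scaleC_right algebra_simps)
    obtain c s where cs: "c\<^sup>2 + s\<^sup>2 = (1 :: real)"
        and Im0: "Im (cinner (c *\<^sub>R v i + s *\<^sub>R w) (A (c *\<^sub>R v i + s *\<^sub>R w))) = 0"
      using quadratic_form_rotation_zero[OF bounded_linear_Im, of "v i" A w] ij qw by auto
    define x where "x = c *\<^sub>R v i + s *\<^sub>R w"
    define y where "y = c *\<^sub>R w - s *\<^sub>R v i"
    have Ax: "A x = c *\<^sub>R A (v i) + s *\<^sub>R A w" "A y = c *\<^sub>R A w - s *\<^sub>R A (v i)"
      by (simp_all add: x_def y_def blinfun.add_right blinfun.diff_right blinfun.scaleR_right)
    have "Re (cinner x (A x)) = 0"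
      using cross less.prems(2)[OF ij(1)] less.prems(2)[OF ij(2)] qw
      unfolding x_def quadratic_form_rotation by simp
    with Im0 have qx: "cinner x (A x) = 0" by (simp add: complex_eq_iff x_def)
    have q: "cinner x (A x) + cinner y (A y) = cinner (v i) (A (v i)) + cinner (v j) (A (v j))"
      using cinner_rotation[OF cs, of "v i" w "A (v i)" "A w"] qw by (simp only: Ax) (simp only: x_def y_def)
    have n: "(norm x)\<^sup>2 + (norm y)\<^sup>2 = (norm (v i))\<^sup>2 + (norm (v j))\<^sup>2"
      using norm_rotation[OF cs, of "v i" w] w(2) by (simp add: x_def y_def)
    have An: "(norm (A x))\<^sup>2 + (norm (A y))\<^sup>2 = (norm (A (v i)))\<^sup>2 + (norm (A (v j)))\<^sup>2"
      using norm_rotation[OF cs, of "A (v i)" "A w"] w(3) by (simp add: Ax)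
    define v' where "v' = v(j := y)"
    have sum': "(\<Sum>k\<in>I - {i}. f (v' k)) = f y + (\<Sum>k\<in>I - {i, j}. f (v k))" for f :: "'a \<Rightarrow> real"
    proof -
      have "(\<Sum>k\<in>I - {i}. f (v' k)) = f (v' j) + (\<Sum>k\<in>I - {i} - {j}. f (v' k))"
        using ij \<open>i \<noteq> j\<close> less.prems(1) by (intro sum.remove) auto
      also have "(\<Sum>k\<in>I - {i} - {j}. f (v' k)) = (\<Sum>k\<in>I - {i, j}. f (v k))"
        by (intro sum.cong) (auto simp: v'_def)
      finally show ?thesis by (simp add: v'_def)
    qed
    note split = sum_split_two[OF less.prems(1) ij(1,2) \<open>i \<noteq> j\<close>]
    have "(\<Sum>k\<in>I - {i}. (norm (A (v' k)))\<^sup>2) \<le> b\<^sup>2 * (\<Sum>k\<in>I - {i}. (norm (v' k))\<^sup>2)"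
    proof (rule less.hyps)
      show "card (I - {i}) < card I" using ij less.prems(1) by (meson card_Diff1_less)
      show "finite (I - {i})" using less.prems by simp
      have "Re (cinner y (A y)) = 0"
        using arg_cong[OF q, of Re] qx less.prems(2) ij by simp
      then show "Re (cinner (v' k) (A (v' k))) = 0" if "k \<in> I - {i}" for k
        using that less.prems(2) by (simp add: v'_def)
      show "(\<Sum>k\<in>I - {i}. Im (cinner (v' k) (A (v' k)))) = 0"
        using sum'[of "\<lambda>z. Im (cinner z (A z))"] split[of "\<lambda>k. Im (cinner (v k) (A (v k)))"]
          less.prems(3) arg_cong[OF q, of Im] qx by simp
    qed
    moreover have "(norm (A x))\<^sup>2 \<le> b\<^sup>2 * (norm x)\<^sup>2" by (rule b[OF qx])
    ultimately have "(norm (A x))\<^sup>2 + (norm (A y))\<^sup>2 + (\<Sum>k\<in>I - {i, j}. (norm (A (v k)))\<^sup>2)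
        \<le> b\<^sup>2 * ((norm x)\<^sup>2 + (norm y)\<^sup>2 + (\<Sum>k\<in>I - {i, j}. (norm (v k))\<^sup>2))"
      unfolding sum'[of "\<lambda>z. (norm (A z))\<^sup>2"] sum'[of "\<lambda>z. (norm z)\<^sup>2"] by (simp add: distrib_left)
    then show ?thesis unfolding n An split .
  qed
qed

text \<open>A family of vectors can be rotated, two vectors at a time, so that a quadratic form of trace
  zero vanishes on each of them; the rotations change none of the sums.\<close>

lemma sum_norm_bound_trace_zero:
  fixes A :: "'a::complex_hilbert \<Rightarrow>\<^sub>L 'a" and v :: "'i \<Rightarrow> 'a"
  assumes A: "A \<in> bounded_ops" and b: "\<And>x. cinner x (A x) = 0 \<Longrightarrow> (norm (A x))\<^sup>2 \<le> b\<^sup>2 * (norm x)\<^sup>2"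
    and fin: "finite I" and "(\<Sum>i\<in>I. cinner (v i) (A (v i))) = 0"
  shows "(\<Sum>i\<in>I. (norm (A (v i)))\<^sup>2) \<le> b\<^sup>2 * (\<Sum>i\<in>I. (norm (v i))\<^sup>2)"
  using assms(4)
\<comment> \<open>The measure counts the real parts still to be cancelled. A rotation clears the one
  at \<open>i\<close>, and the one at \<open>j\<close> was counted already, so the number drops.
  Imaginary parts are left to the preceding lemma.\<close>
proof (induction "card {i\<in>I. Re (cinner (v i) (A (v i))) \<noteq> 0}" arbitrary: v rule: less_induct)
  case less
  have Re0: "(\<Sum>i\<in>I. Re (cinner (v i) (A (v i)))) = 0" and Im0: "(\<Sum>i\<in>I. Im (cinner (v i) (A (v i)))) = 0"
    using arg_cong[OF less.prems, of Re] arg_cong[OF less.prems, of Im] by simp_all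
  show ?case
  proof (cases "\<forall>i\<in>I. Re (cinner (v i) (A (v i))) = 0")
    case True
    then show ?thesis using sum_norm_bound_imaginary_diagonal[OF A b fin] Im0 by blast
  next
    case False
    then obtain i j where ij: "i \<in> I" "j \<in> I" "Re (cinner (v i) (A (v i))) > 0"
        "Re (cinner (v j) (A (v j))) < 0"
      using sum_zero_signs[OF fin Re0] by blast
    then have "i \<noteq> j" by auto
    obtain c s where cs: "c\<^sup>2 + s\<^sup>2 = (1 :: real)"
        and x0: "Re (cinner (c *\<^sub>R v i + s *\<^sub>R v j) (A (c *\<^sub>R v i + s *\<^sub>R v j))) = 0"
      using quadratic_form_rotation_zero[OF bounded_linear_Re, of "v i" A "v j"] ij by auto
    define x where "x = c *\<^sub>R v i + s *\<^sub>R v j"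
    define y where "y = c *\<^sub>R v j - s *\<^sub>R v i"
    have Ax: "A x = c *\<^sub>R A (v i) + s *\<^sub>R A (v j)" "A y = c *\<^sub>R A (v j) - s *\<^sub>R A (v i)"
      by (simp_all add: x_def y_def blinfun.add_right blinfun.diff_right blinfun.scaleR_right)
    have q: "cinner x (A x) + cinner y (A y) = cinner (v i) (A (v i)) + cinner (v j) (A (v j))"
      using cinner_rotation[OF cs, of "v i" "v j" "A (v i)" "A (v j)"]
      by (simp only: Ax) (simp only: x_def y_def)
    have n: "(norm x)\<^sup>2 + (norm y)\<^sup>2 = (norm (v i))\<^sup>2 + (norm (v j))\<^sup>2"
      using norm_rotation[OF cs, of "v i" "v j"] by (simp add: x_def y_def)
    have An: "(norm (A x))\<^sup>2 + (norm (A y))\<^sup>2 = (norm (A (v i)))\<^sup>2 + (norm (A (v j)))\<^sup>2"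
      using norm_rotation[OF cs, of "A (v i)" "A (v j)"] by (simp add: Ax)
    define v' where "v' = v(i := x, j := y)"
    have sum': "(\<Sum>k\<in>I. f (v' k)) = f x + f y + (\<Sum>k\<in>I - {i, j}. f (v k))"
      for f :: "'a \<Rightarrow> 'b::comm_monoid_add"
    proof -
      have "(\<Sum>k\<in>I - {i, j}. f (v' k)) = (\<Sum>k\<in>I - {i, j}. f (v k))"
        by (intro sum.cong) (auto simp: v'_def)
      then show ?thesis
        using sum_split_two[OF fin ij(1,2) \<open>i \<noteq> j\<close>, of "\<lambda>k. f (v' k)"] \<open>i \<noteq> j\<close>
        by (simp add: v'_def)
    qed
    note split = sum_split_two[OF fin ij(1,2) \<open>i \<noteq> j\<close>]
    have "(\<Sum>k\<in>I. (norm (A (v' k)))\<^sup>2) \<le> b\<^sup>2 * (\<Sum>k\<in>I. (norm (v' k))\<^sup>2)"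
    proof (rule less.hyps)
      have "Re (cinner x (A x)) = 0" using x0 by (simp only: x_def)
      then have "k \<noteq> i \<and> Re (cinner (v k) (A (v k))) \<noteq> 0" if "Re (cinner (v' k) (A (v' k))) \<noteq> 0" for k
        using that ij(4) \<open>i \<noteq> j\<close> by (cases "k = j"; cases "k = i") (auto simp: v'_def)
      then have "{k\<in>I. Re (cinner (v' k) (A (v' k))) \<noteq> 0} \<subset> {k\<in>I. Re (cinner (v k) (A (v k))) \<noteq> 0}"
        using ij(1,3) by fastforce
      then show "card {k\<in>I. Re (cinner (v' k) (A (v' k))) \<noteq> 0}
          < card {k\<in>I. Re (cinner (v k) (A (v k))) \<noteq> 0}"
        using fin by (intro psubset_card_mono) auto
      show "(\<Sum>k\<in>I. cinner (v' k) (A (v' k))) = 0"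
        using less.prems split[of "\<lambda>k. cinner (v k) (A (v k))"] q
        unfolding sum'[of "\<lambda>z. cinner z (A z)"] by simp
    qed
    then show ?thesis
      unfolding sum'[of "\<lambda>z. (norm (A z))\<^sup>2"] sum'[of "\<lambda>z. (norm z)\<^sup>2"] n An split .
  qed
qed

section \<open>The nearest scalar and the mixed states it produces\<close>

lemma minimal_norm_scalar_shift:
  fixes T :: "'a::complex_hilbert \<Rightarrow>\<^sub>L 'a"
  assumes x0: "norm (x0 :: 'a) = 1"
  shows "\<exists>l. \<forall>m. norm (T - op_scaleC l id_blinfun) \<le> norm (T - op_scaleC m id_blinfun)"
proof -
  define N where "N m = norm (T - op_scaleC m id_blinfun)" for m
  \<comment> \<open>Outside this compact disc the shifted norm is at least
    \<open>cmod m - norm T\<close>, hence at least \<open>norm T\<close>, the value at 0. So a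
    minimum over the disc is global.\<close>
  have "continuous_on (cball 0 (2 * norm T)) N"
    unfolding N_def by (intro continuous_intros bounded_linear.continuous_on[OF bounded_linear_scalar_op])
  then have "\<exists>l\<in>cball 0 (2 * norm T). \<forall>m\<in>cball 0 (2 * norm T). N l \<le> N m"
    by (intro continuous_attains_inf) auto
  then obtain l where l: "\<And>m. m \<in> cball 0 (2 * norm T) \<Longrightarrow> N l \<le> N m" by blast
  have "N l \<le> N m" for m
  proof (cases "m \<in> cball 0 (2 * norm T)")
    case False
    have "cmod m = norm ((op_scaleC m id_blinfun) x0)"
      using x0 by (simp add: scalar_op_apply norm_scaleC)
    also have "\<dots> \<le> norm (op_scaleC m (id_blinfun :: 'a \<Rightarrow>\<^sub>L 'a))"
      using norm_blinfun[of "op_scaleC m id_blinfun" x0] x0 by simp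
    finally have "cmod m - norm T \<le> N m"
      using norm_triangle_ineq2[of "op_scaleC m id_blinfun" T] unfolding N_def norm_minus_commute[of T]
      by linarith
    moreover have "N l \<le> N 0" using l[of 0] by simp
    moreover have "N 0 = norm T" by (simp add: N_def)
    ultimately show ?thesis using False by (simp add: dist_norm)
  qed (rule l)
  then show ?thesis unfolding N_def by blast
qed

lemma norm_scalar_shift_power2:
  fixes A :: "'a::complex_hilbert \<Rightarrow>\<^sub>L 'a"
  assumes "norm x = 1"
  shows "(norm (A x - m *\<^sub>C x))\<^sup>2 = (norm (A x))\<^sup>2 - 2 * Re (cnj m * cinner x (A x)) + (cmod m)\<^sup>2"
  using assms cinner_commute[of "A x" x]
  by (simp add: norm_diff_power2 norm_scaleC cinner_scaleC_right)

text \<open>Points of the hull record mean and second moment of mixtures of unit vectors. If the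
  given point were separated from them, the separating functional would point to a scalar shift that
  strictly lowers the norm of \<open>A\<close>.\<close>

lemma minimal_norm_in_closure_hull:
  fixes A :: "'a::complex_hilbert \<Rightarrow>\<^sub>L 'a"
  assumes x0: "norm (x0 :: 'a) = 1" and min: "\<And>m. norm A \<le> norm (A - op_scaleC m id_blinfun)"
  shows "(0, (norm A)\<^sup>2) \<in> closure (convex hull ((\<lambda>x. (cinner x (A x), (norm (A x))\<^sup>2)) ` {x. norm x = 1}))"
    (is "_ \<in> closure (convex hull ?P)")
proof (rule ccontr)
  define d where "d = norm A"
  assume "\<not> ?thesis"
  then obtain a \<gamma> where a: "inner a (0, d\<^sup>2) < \<gamma>" "\<And>p. p \<in> closure (convex hull ?P) \<Longrightarrow> \<gamma> < inner a p"
    using separating_hyperplane_closed_point[of "closure (convex hull ?P)" "(0, d\<^sup>2)"]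
      convex_closure[OF convex_convex_hull, of ?P] closed_closure unfolding d_def by blast
  obtain \<nu> s where a_eq: "a = (\<nu>, s)" by (cases a)
  have sep: "\<gamma> < Re (cnj \<nu> * cinner x (A x)) + s * (norm (A x))\<^sup>2" if "norm x = 1" for x
  proof -
    have "(cinner x (A x), (norm (A x))\<^sup>2) \<in> closure (convex hull ?P)"
      using that by (intro closure_subset[THEN subsetD] hull_inc imageI) simp
    from a(2)[OF this] show ?thesis
      by (simp add: a_eq inner_complex_def)
  qed
  define \<eta> where "\<eta> = \<gamma> - s * d\<^sup>2"
  have "\<eta> > 0" using a(1) by (simp add: a_eq \<eta>_def)
  \<comment> \<open>The first bound keeps \<open>1 + 2 * t * s\<close> non-negative, so that the
    second moment may be replaced by its bound \<open>d\<^sup>2\<close>. The second keeps the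
    quadratic cost \<open>t\<^sup>2 * (cmod \<nu>)\<^sup>2\<close> below half of the linear gain
    \<open>2 * t * \<eta>\<close>.\<close>
  define t where "t = min (1 / (2 * (\<bar>s\<bar> + 1))) (\<eta> / ((cmod \<nu>)\<^sup>2 + 1))"
  have t: "0 < t" using \<open>\<eta> > 0\<close> by (auto simp: t_def add_nonneg_pos)
  have "2 * t * \<bar>s\<bar> \<le> 1"
  proof -
    have "t * (2 * (\<bar>s\<bar> + 1)) \<le> 1"
      using min.cobounded1[of "1 / (2 * (\<bar>s\<bar> + 1))" "\<eta> / ((cmod \<nu>)\<^sup>2 + 1)"]
      unfolding t_def[symmetric] by (subst (asm) pos_le_divide_eq) auto
    then show ?thesis using t by (simp add: algebra_simps)
  qed
  then have ts: "0 \<le> 1 + 2 * t * s" using t by (cases "0 \<le> s") auto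
  have t\<nu>: "t * (cmod \<nu>)\<^sup>2 < \<eta>"
  proof -
    have "t * ((cmod \<nu>)\<^sup>2 + 1) \<le> \<eta>"
      using min.cobounded2[of "1 / (2 * (\<bar>s\<bar> + 1))" "\<eta> / ((cmod \<nu>)\<^sup>2 + 1)"]
      unfolding t_def[symmetric] by (subst (asm) pos_le_divide_eq) (auto simp: add_nonneg_pos)
    then show ?thesis using t by (simp add: algebra_simps)
  qed
  define r where "r = d\<^sup>2 - 2 * t * \<eta> + t\<^sup>2 * (cmod \<nu>)\<^sup>2"
  have "t * (t * (cmod \<nu>)\<^sup>2) < t * \<eta>" using t t\<nu> by (intro mult_strict_left_mono)
  then have r: "r < d\<^sup>2" using t \<open>\<eta> > 0\<close> by (simp add: r_def power2_eq_square)
  define m where "m = complex_of_real t * \<nu>"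
  have bound: "(norm (A x - m *\<^sub>C x))\<^sup>2 \<le> r" if x: "norm x = 1" for x
  proof -
    have "(norm (A x))\<^sup>2 \<le> d\<^sup>2"
      using norm_blinfun[of A x] x by (intro power_mono) (auto simp: d_def)
    then have *: "(1 + 2 * t * s) * (norm (A x))\<^sup>2 \<le> (1 + 2 * t * s) * d\<^sup>2"
      using ts by (rule mult_left_mono)
    have "2 * t * \<gamma> \<le> 2 * t * (Re (cnj \<nu> * cinner x (A x)) + s * (norm (A x))\<^sup>2)"
      using sep[OF x] t by (intro mult_left_mono) auto
    moreover have "Re (cnj m * cinner x (A x)) = t * Re (cnj \<nu> * cinner x (A x))"
      by (simp add: m_def algebra_simps)
    moreover have "(cmod m)\<^sup>2 = t\<^sup>2 * (cmod \<nu>)\<^sup>2"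
      by (simp add: m_def norm_mult power_mult_distrib)
    ultimately show ?thesis
      using * unfolding norm_scalar_shift_power2[OF x] r_def \<eta>_def by (simp add: algebra_simps)
  qed
  have "norm (A - op_scaleC m id_blinfun) \<le> sqrt r"
  proof (rule norm_blinfun_le_unit)
    show "0 \<le> sqrt r" using order_trans[OF zero_le_power2 bound[OF x0]] by simp
    fix x :: 'a assume x: "norm x = 1"
    show "norm ((A - op_scaleC m id_blinfun) x) \<le> sqrt r"
      using bound[OF x] by (intro real_le_rsqrt) (simp add: blinfun.diff_left scalar_op_apply)
  qed
  also have "sqrt r < sqrt (d\<^sup>2)" using r by (rule real_sqrt_less_mono)
  also have "\<dots> = norm A" by (simp add: d_def)
  finally show False using min[of m] by simp
qed

text \<open>Stampfli's theorem. At the nearest scalar, the separating hyperplane theorem provides a mixed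
  state whose variance is almost the squared distance; splitting the mixed state into pure states
  with the same mean turns it into a bound for pure states.\<close>

theorem stampfli_distance_formula:
  fixes T :: "'a::complex_hilbert \<Rightarrow>\<^sub>L 'a"
  assumes T: "T \<in> bounded_ops" and x0: "norm (x0 :: 'a) = 1" and "0 \<le> b"
    and le: "\<And>u v. cinner u v = 0 \<Longrightarrow> cmod (cinner u (T v)) \<le> b * norm u * norm v"
  shows "\<exists>l. norm (T - op_scaleC l id_blinfun) \<le> b"
proof -
  \<comment> \<open>The shifted image of \<open>v\<close> is itself orthogonal to \<open>v\<close>,
    hence admissible as \<open>u\<close> in the hypothesis, where the scalar \<open>m\<close> drops
    out.\<close>
  have shift: "(norm ((T - op_scaleC m id_blinfun) v))\<^sup>2 \<le> b\<^sup>2 * (norm v)\<^sup>2"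
    if 0: "cinner v ((T - op_scaleC m id_blinfun) v) = 0" for m v
  proof -
    define w where "w = (T - op_scaleC m id_blinfun) v"
    have wv: "cinner w v = 0" using 0 cinner_commute[of w v] by (simp add: w_def)
    have "cinner w w = cinner w (T v) - m * cinner w v"
      by (subst (2) w_def) (simp add: blinfun.diff_left scalar_op_apply cinner_diff_right cinner_scaleC_right)
    then have "cmod (cinner w w) \<le> b * norm w * norm v" using le[OF wv] wv by simp
    then have "norm w * norm w \<le> norm w * (b * norm v)"
      by (simp add: cinner_norm norm_mult power2_eq_square mult_ac)
    then have "norm w \<le> b * norm v" using \<open>0 \<le> b\<close> by (cases "w = 0") auto
    then show ?thesis
      unfolding w_def[symmetric] power_mult_distrib[symmetric] by (intro power_mono) auto
  qed
  obtain l where l: "\<And>m. norm (T - op_scaleC l id_blinfun) \<le> norm (T - op_scaleC m id_blinfun)"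
    using minimal_norm_scalar_shift[OF x0] by blast
  define A where "A = T - op_scaleC l id_blinfun"
  have A_shift: "A - op_scaleC m id_blinfun = T - op_scaleC (l + m) id_blinfun" for m
    by (simp add: A_def op_space.scale_left_distrib)
  have "norm A \<le> norm (A - op_scaleC m id_blinfun)" for m
    unfolding A_shift using l by (simp add: A_def)
  from minimal_norm_in_closure_hull[OF x0 this]
  have hull: "(0, (norm A)\<^sup>2) \<in> closure (convex hull ((\<lambda>x. (cinner x (A x), (norm (A x))\<^sup>2)) ` {x. norm x = 1}))" .
  have "(norm A)\<^sup>2 \<le> b\<^sup>2 + \<epsilon>" if "0 < \<epsilon>" for \<epsilon>
  proof -
    \<comment> \<open>Two errors of size \<open>e\<close> must fit into \<open>\<epsilon>\<close>:
      that of the second moment and the squared mean, for which \<open>e \<le> 1\<close> gives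
      \<open>e\<^sup>2 \<le> e\<close>.\<close>
    define e where "e = min 1 (\<epsilon> / 2)"
    have e: "0 < e" "e \<le> 1" "2 * e \<le> \<epsilon>" using that by (auto simp: e_def)
    obtain p where p: "p \<in> convex hull ((\<lambda>x. (cinner x (A x), (norm (A x))\<^sup>2)) ` {x. norm x = 1})"
        and dist: "dist p (0, (norm A)\<^sup>2) < e"
      using hull e(1) unfolding closure_approachable by blast
    define m q where "m = fst p" and "q = snd p"
    have m: "cmod m < e" and q: "(norm A)\<^sup>2 - e < q"
      using dist_fst_le[of p "(0, (norm A)\<^sup>2)"] dist_snd_le[of p "(0, (norm A)\<^sup>2)"] dist
      by (auto simp: m_def q_def dist_norm)
    obtain S w where S: "finite S" "S \<subseteq> (\<lambda>x. (cinner x (A x), (norm (A x))\<^sup>2)) ` {x. norm x = 1}"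
        and w: "\<And>s. s \<in> S \<Longrightarrow> 0 \<le> w s" "sum w S = 1" "(\<Sum>s\<in>S. w s *\<^sub>R s) = p"
      using p unfolding convex_hull_explicit by blast
    have "\<forall>s\<in>S. \<exists>x. norm x = 1 \<and> s = (cinner x (A x), (norm (A x))\<^sup>2)" using S(2) by blast
    then obtain X where X: "\<And>s. s \<in> S \<Longrightarrow> norm (X s) = 1"
        "\<And>s. s \<in> S \<Longrightarrow> s = (cinner (X s) (A (X s)), (norm (A (X s)))\<^sup>2)"
      by metis
    have m_eq: "(\<Sum>s\<in>S. of_real (w s) * cinner (X s) (A (X s))) = m"
    proof -
      have "m = (\<Sum>s\<in>S. w s *\<^sub>R fst s)" by (simp add: m_def w(3)[symmetric] fst_sum)
      also have "\<dots> = (\<Sum>s\<in>S. of_real (w s) * cinner (X s) (A (X s)))"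
        using arg_cong[OF X(2), of _ fst] by (intro sum.cong) (simp_all add: scaleR_conv_of_real)
      finally show ?thesis by simp
    qed
    have q_eq: "(\<Sum>s\<in>S. w s * (norm (A (X s)))\<^sup>2) = q"
    proof -
      have "q = (\<Sum>s\<in>S. w s *\<^sub>R snd s)" by (simp add: q_def w(3)[symmetric] snd_sum)
      also have "\<dots> = (\<Sum>s\<in>S. w s * (norm (A (X s)))\<^sup>2)"
        using arg_cong[OF X(2), of _ snd] by (intro sum.cong) simp_all
      finally show ?thesis by simp
    qed
    \<comment> \<open>The mean of the mixture is only near 0. Recentring at the exact mean
      \<open>m\<close> makes the weighted trace vanish, as the rotation argument demands; the
      weights enter the vectors as square roots.\<close>
    define D where "D = A - op_scaleC m id_blinfun"
    have D: "D \<in> bounded_ops" unfolding D_def A_def by (intro bounded_ops_diff T scalar_op_bounded_ops)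
    have Dx: "D x = A x - m *\<^sub>C x" for x by (simp add: D_def blinfun.diff_left scalar_op_apply)
    define v where "v s = sqrt (w s) *\<^sub>R X s" for s
    have "(\<Sum>s\<in>S. cinner (v s) (D (v s))) = (\<Sum>s\<in>S. of_real (w s) * cinner (X s) (A (X s)) - of_real (w s) * m)"
    proof (rule sum.cong[OF refl])
      fix s assume s: "s \<in> S"
      have "cinner (v s) (D (v s)) = of_real (sqrt (w s) * sqrt (w s)) * cinner (X s) (D (X s))"
        by (simp add: v_def blinfun.scaleR_right cinner_scaleR_left cinner_scaleR_right
            del: real_sqrt_mult_self)
      also have "cinner (X s) (D (X s)) = cinner (X s) (A (X s)) - m"
        using X(1)[OF s] by (simp add: Dx cinner_diff_right cinner_scaleC_right cinner_norm)
      finally show "cinner (v s) (D (v s)) = of_real (w s) * cinner (X s) (A (X s)) - of_real (w s) * m"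
        using w(1)[OF s] by (simp add: algebra_simps)
    qed
    also have "\<dots> = 0"
      using w(2) by (simp add: sum_subtractf m_eq flip: sum_distrib_right of_real_sum)
    finally have "(\<Sum>s\<in>S. (norm (D (v s)))\<^sup>2) \<le> b\<^sup>2 * (\<Sum>s\<in>S. (norm (v s))\<^sup>2)"
      by (intro sum_norm_bound_trace_zero[OF D _ S(1)]) (use shift in \<open>auto simp: D_def A_shift\<close>)
    also have "(\<Sum>s\<in>S. (norm (v s))\<^sup>2) = 1"
      using w X(1) by (simp add: v_def power_mult_distrib)
    also have "(\<Sum>s\<in>S. (norm (D (v s)))\<^sup>2) = (\<Sum>s\<in>S. w s * (norm (A (X s)))\<^sup>2
        - 2 * Re (cnj m * (of_real (w s) * cinner (X s) (A (X s)))) + w s * (cmod m)\<^sup>2)"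
    proof (rule sum.cong[OF refl])
      fix s assume s: "s \<in> S"
      have "(norm (D (v s)))\<^sup>2 = w s * (norm (A (X s) - m *\<^sub>C X s))\<^sup>2"
        using w(1)[OF s] by (simp add: v_def blinfun.scaleR_right power_mult_distrib Dx)
      then show "(norm (D (v s)))\<^sup>2 = w s * (norm (A (X s)))\<^sup>2
        - 2 * Re (cnj m * (of_real (w s) * cinner (X s) (A (X s)))) + w s * (cmod m)\<^sup>2"
        unfolding norm_scalar_shift_power2[OF X(1)[OF s]] by (simp add: algebra_simps)
    qed
    \<comment> \<open>Variance identity: second moment minus squared modulus of the mean.\<close>
    also have "\<dots> = q - 2 * Re (cnj m * m) + (cmod m)\<^sup>2"
    proof -
      have "(\<Sum>s\<in>S. Re (cnj m * (of_real (w s) * cinner (X s) (A (X s))))) = Re (cnj m * m)"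
        by (subst (3) m_eq[symmetric]) (simp only: sum_distrib_left Re_sum)
      then show ?thesis
        using w(2) by (simp only: sum.distrib sum_subtractf q_eq flip: sum_distrib_left sum_distrib_right)
    qed
    also have "Re (cnj m * m) = (cmod m)\<^sup>2" by (simp add: cmod_power2) (simp add: power2_eq_square)
    finally have "q \<le> b\<^sup>2 + (cmod m)\<^sup>2" by simp
    moreover have "(cmod m)\<^sup>2 \<le> e"
    proof -
      have "(cmod m)\<^sup>2 \<le> e\<^sup>2" using m by (intro power_mono) auto
      also have "\<dots> \<le> e" using e by (simp add: power2_eq_square mult_left_le)
      finally show ?thesis .
    qed
    ultimately show ?thesis using q e(3) by linarith
  qed
  then have "(norm A)\<^sup>2 \<le> b\<^sup>2" by (rule field_le_epsilon)
  then have "norm A \<le> b" using \<open>0 \<le> b\<close> by (rule power2_le_imp_le)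
  then show ?thesis unfolding A_def by blast
qed

section \<open>The weak operator topology\<close>

lemma topspace_weak_operator_topology [simp]: "topspace weak_operator_topology = UNIV"
  by (simp add: weak_operator_topology_def topspace_pullback_topology)

lemma continuous_map_wot_coefficient:
  "continuous_map weak_operator_topology euclidean
    (\<lambda>T :: 'a::complex_hilbert \<Rightarrow>\<^sub>L 'a. cinner x (blinfun_apply T y))"
proof -
  have "continuous_map euclidean euclidean (\<lambda>h :: 'a \<times> 'a \<Rightarrow> complex. h (x, y))"
    by (simp add: continuous_on_product_coordinates)
  from continuous_map_pullback[OF this, of UNIV "\<lambda>T (x, y). cinner x (blinfun_apply T y)"]
  show ?thesis by (simp add: weak_operator_topology_def o_def)
qed

text \<open>Common form of the bounded operators, the scalars and the ampliations: each is described
  by equations between coefficients. A scalar factor in such an equation is moved, conjugated, into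
  the left vector.\<close>

lemma closedin_wot_coefficient_eqs:
  "closedin weak_operator_topology
    {T :: 'a::complex_hilbert \<Rightarrow>\<^sub>L 'a. \<forall>i. cinner (a i) (blinfun_apply T (b i)) = cinner (c i) (blinfun_apply T (d i))}"
proof -
  have "closedin weak_operator_topology
      {T \<in> topspace weak_operator_topology. cinner (a i) (blinfun_apply T (b i)) = cinner (c i) (blinfun_apply T (d i))}" for i
    by (rule closedin_continuous_maps_eq[OF Hausdorff_space_euclidean]) (rule continuous_map_wot_coefficient)+
  then have "closedin weak_operator_topology
      (\<Inter>i. {T. cinner (a i) (blinfun_apply T (b i)) = cinner (c i) (blinfun_apply T (d i))})"
    by (intro closedin_Inter) auto
  then show ?thesis by (simp add: Collect_all_eq)
qed

text \<open>Coefficients are norm continuous. This shows later that the norm closure in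
  \<open>spatial_tensor\<close> adds nothing.\<close>

lemma closedin_wot_imp_closed:
  fixes C :: "('a::complex_hilbert \<Rightarrow>\<^sub>L 'a) set"
  assumes "closedin weak_operator_topology C"
  shows "closed C"
proof -
  have "continuous_on UNIV (\<lambda>T :: 'a \<Rightarrow>\<^sub>L 'a. \<lambda>(x, y). cinner x (blinfun_apply T y))"
  proof (rule continuous_on_coordinatewise_then_product)
    fix p :: "'a \<times> 'a"
    show "continuous_on UNIV (\<lambda>T :: 'a \<Rightarrow>\<^sub>L 'a. case p of (x, y) \<Rightarrow> cinner x (blinfun_apply T y))"
      by (cases p) (auto intro!: continuous_on_cinner_right continuous_intros)
  qed
  then have "continuous_map euclidean weak_operator_topology (\<lambda>T :: 'a \<Rightarrow>\<^sub>L 'a. T)"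
    unfolding weak_operator_topology_def
    by (intro continuous_map_pullback') (auto simp: o_def)
  from closedin_continuous_map_preimage[OF this assms] show ?thesis by simp
qed

lemma closedin_wot_bounded_ops:
  "closedin weak_operator_topology (bounded_ops :: ('a::complex_hilbert \<Rightarrow>\<^sub>L 'a) set)"
proof -
  have eq: "bounded_ops = {T :: 'a \<Rightarrow>\<^sub>L 'a. \<forall>i :: complex \<times> 'a \<times> 'a.
      cinner (snd (snd i)) (blinfun_apply T (fst i *\<^sub>C fst (snd i)))
      = cinner (cnj (fst i) *\<^sub>C snd (snd i)) (blinfun_apply T (fst (snd i)))}"
    by (auto simp: bounded_ops_def cinner_scaleC_left cinner_scaleC_right intro: cinner_ext)
  show ?thesis unfolding eq by (rule closedin_wot_coefficient_eqs)
qed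

lemma bounded_ops_op_scaleC: "T \<in> bounded_ops \<Longrightarrow> op_scaleC c T \<in> bounded_ops"
  by (simp add: bounded_ops_def op_scaleC_apply scaleC_scaleC mult.commute)

lemma subspace_scalar_ops: "op_space.subspace scalar_ops"
proof (rule op_space.subspaceI)
  show "0 \<in> scalar_ops"
    unfolding scalar_ops_def by (rule CollectI, rule exI[of _ 0]) simp
  fix x y assume "x \<in> (scalar_ops :: ('a \<Rightarrow>\<^sub>L 'a) set)" "y \<in> (scalar_ops :: ('a \<Rightarrow>\<^sub>L 'a) set)"
  then show "x + y \<in> scalar_ops"
    unfolding scalar_ops_def by (auto simp flip: op_space.scale_left_distrib)
next
  fix c x assume "x \<in> (scalar_ops :: ('a \<Rightarrow>\<^sub>L 'a) set)"
  then show "op_scaleC c x \<in> scalar_ops" unfolding scalar_ops_def by auto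
qed

text \<open>The unit vector reads off the scalar as \<open>cinner e (T e)\<close>, which turns
  membership into equations between coefficients.\<close>

lemma closedin_wot_scalar_ops:
  fixes e :: "'a::complex_hilbert"
  assumes "norm e = 1"
  shows "closedin weak_operator_topology (scalar_ops :: ('a \<Rightarrow>\<^sub>L 'a) set)"
proof -
  have "T \<in> scalar_ops \<longleftrightarrow> (\<forall>i. cinner (fst i) (T (snd i)) = cinner (cnj (cinner (fst i) (snd i)) *\<^sub>C e) (T e))"
    (is "_ \<longleftrightarrow> ?R") for T :: "'a \<Rightarrow>\<^sub>L 'a"
  proof
    assume "T \<in> scalar_ops"
    then obtain c where "T = op_scaleC c id_blinfun" by (auto simp: scalar_ops_def)
    then show ?R
      using assms by (simp add: scalar_op_apply cinner_scaleC_left cinner_scaleC_right cinner_norm)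
  next
    assume R: ?R
    have "cinner x (T y) = cinner x (cinner e (T e) *\<^sub>C y)" for x y
      using R[THEN spec, of "(x, y)"] by (simp add: cinner_scaleC_left cinner_scaleC_right mult.commute)
    then have Ty: "T y = cinner e (T e) *\<^sub>C y" for y by (rule cinner_ext)
    have "T = op_scaleC (cinner e (T e)) id_blinfun"
      by (rule blinfun_eqI, unfold scalar_op_apply) (rule Ty)
    then show "T \<in> scalar_ops" by (auto simp: scalar_ops_def)
  qed
  then have "scalar_ops = {T :: 'a \<Rightarrow>\<^sub>L 'a. \<forall>i. cinner (fst i) (T (snd i)) = cinner (cnj (cinner (fst i) (snd i)) *\<^sub>C e) (T e)}"
    by blast
  then show ?thesis by (rule ssubst) (rule closedin_wot_coefficient_eqs)
qed

section \<open>Orthonormal systems\<close>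

definition orthonormal :: "'a::complex_hilbert set \<Rightarrow> bool" where
  "orthonormal F \<longleftrightarrow> (\<forall>f\<in>F. \<forall>g\<in>F. cinner f g = (if f = g then 1 else 0))"

lemma orthonormal_cinner: "orthonormal F \<Longrightarrow> f \<in> F \<Longrightarrow> g \<in> F \<Longrightarrow> cinner f g = (if f = g then 1 else 0)"
  by (simp add: orthonormal_def)

lemma orthonormal_norm: "orthonormal F \<Longrightarrow> f \<in> F \<Longrightarrow> norm f = 1"
  using orthonormal_cinner[of F f f] norm_power2_eqI[of f 1] by (simp add: abs_square_eq_1)

lemma orthonormal_expansion_mono:
  assumes "orthonormal F'" "finite F'" "F \<subseteq> F'" "b = (\<Sum>f\<in>F. cinner f b *\<^sub>C f)"
  shows "b = (\<Sum>f\<in>F'. cinner f b *\<^sub>C f)"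
proof -
  have "cinner g b = 0" if g: "g \<in> F' - F" for g
  proof -
    have "cinner g b = (\<Sum>f\<in>F. cinner f b * cinner g f)"
      by (subst assms(4)) (simp add: cinner_sum_right cinner_scaleC_right)
    also have "\<dots> = 0" using g assms(1,3) by (intro sum.neutral) (auto simp: orthonormal_def subset_iff)
    finally show ?thesis .
  qed
  then show ?thesis
    using assms(2,3) by (subst assms(4)) (intro sum.mono_neutral_left, auto)
qed

text \<open>Spanning is stated as an expansion because this is what puts tensors into normal form
  later. Keeping \<open>F0\<close> allows a prescribed unit vector to remain in the system.\<close>

lemma gram_schmidt_extend:
  fixes B :: "'a::complex_hilbert set"
  assumes "finite B" "finite F0" "orthonormal F0"
  shows "\<exists>F. finite F \<and> orthonormal F \<and> F0 \<subseteq> F \<and> (\<forall>b\<in>B. b = (\<Sum>f\<in>F. cinner f b *\<^sub>C f))"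
  using assms(1)
proof (induction B rule: finite_induct)
  case empty
  then show ?case using assms by blast
next
  case (insert b B)
  then obtain F where F: "finite F" "orthonormal F" "F0 \<subseteq> F"
      and B: "\<And>b. b \<in> B \<Longrightarrow> b = (\<Sum>f\<in>F. cinner f b *\<^sub>C f)"
    by blast
  define r where "r = b - (\<Sum>f\<in>F. cinner f b *\<^sub>C f)"
  have r: "cinner g r = 0" if "g \<in> F" for g
  proof -
    have "(\<Sum>f\<in>F. cinner f b * cinner g f) = (\<Sum>f\<in>F. if f = g then cinner f b else 0)"
      using that F(2) by (intro sum.cong) (auto simp: orthonormal_def)
    then show ?thesis
      using that F(1) by (simp add: r_def cinner_diff_right cinner_sum_right cinner_scaleC_right)
  qed
  show ?case
  proof (cases "r = 0")
    case True
    then have "b = (\<Sum>f\<in>F. cinner f b *\<^sub>C f)" by (simp add: r_def)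
    then show ?thesis using F B by (intro exI[of _ F]) auto
  next
    case False
    define h where "h = (1 / norm r) *\<^sub>R r"
    have gh: "cinner g h = 0" if "g \<in> F" for g
      using r[OF that] by (simp add: h_def cinner_scaleR_right)
    then have hg: "cinner h g = 0" if "g \<in> F" for g
      using that cinner_commute[of h g] by simp
    have hh: "cinner h h = 1" using False by (simp add: cinner_norm h_def)
    then have "h \<notin> F" using gh by auto
    then have on: "orthonormal (insert h F)"
      using F(2) gh hg hh by (auto simp: orthonormal_def)
    have "cinner h b = cinner h r"
      using hg by (simp add: r_def cinner_diff_right cinner_sum_right cinner_scaleC_right)
    also have "\<dots> = of_real (norm r)"
      using False by (simp add: h_def cinner_scaleR_left cinner_norm power2_eq_square)
    finally have "cinner h b *\<^sub>C h = r" using False by (simp add: h_def flip: scaleR_scaleC)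
    then have "b = (\<Sum>f\<in>insert h F. cinner f b *\<^sub>C f)"
      using \<open>h \<notin> F\<close> F(1) by (simp add: r_def)
    moreover have "c = (\<Sum>f\<in>insert h F. cinner f c *\<^sub>C f)" if "c \<in> B" for c
      using orthonormal_expansion_mono[OF on _ _ B[OF that]] F(1) by blast
    ultimately show ?thesis
      using F on by (intro exI[of _ "insert h F"]) auto
  qed
qed

lemma orthonormal_pair_exists:
  fixes x y :: "'a::complex_hilbert"
  assumes "x \<noteq> 0" "y \<notin> complex_space.span {x}"
  shows "\<exists>e1 e2 :: 'a. norm e1 = 1 \<and> norm e2 = 1 \<and> cinner e1 e2 = 0"
proof -
  define e where "e = (1 / norm x) *\<^sub>R x"
  have e: "cinner e e = 1" using assms(1) by (simp add: e_def cinner_norm)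
  then have "orthonormal {e}" by (simp add: orthonormal_def)
  then obtain F where F: "finite F" "orthonormal F" "{e} \<subseteq> F" "y = (\<Sum>f\<in>F. cinner f y *\<^sub>C f)"
    using gram_schmidt_extend[of "{y}" "{e}"] by auto
  have "F \<noteq> {e}"
  proof
    assume "F = {e}"
    then have "y = (cinner e y * of_real (1 / norm x)) *\<^sub>C x"
      using F(4) by (simp add: e_def scaleR_scaleC scaleC_scaleC)
    then show False
      using assms(2) by (metis complex_space.span_base complex_space.span_scale singletonI)
  qed
  then obtain f where "f \<in> F" "f \<noteq> e" using F(3) by blast
  then show ?thesis
    using F(2,3) orthonormal_norm[OF F(2)] orthonormal_cinner[OF F(2), of e f]
    by (intro exI[of _ e] exI[of _ f]) auto
qed

section \<open>Slices and ampliations\<close>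

locale tensor_product =
  fixes tens :: "'h::complex_hilbert \<Rightarrow> 'k::complex_hilbert \<Rightarrow> 'l::complex_hilbert"
  assumes tens: "hilbert_tensor tens"
begin

lemma tens_add_left: "tens (x + x') y = tens x y + tens x' y"
  and tens_add_right: "tens x (y + y') = tens x y + tens x y'"
  and tens_scaleC_left: "tens (c *\<^sub>C x) y = c *\<^sub>C tens x y"
  and tens_scaleC_right: "tens x (c *\<^sub>C y) = c *\<^sub>C tens x y"
  and cinner_tens: "cinner (tens x y) (tens x' y') = cinner x x' * cinner y y'"
  and dense: "closure (complex_space.span {tens x y | x y. True}) = UNIV"
  using tens unfolding hilbert_tensor_def by blast+

lemma tens_scaleR_left: "tens (r *\<^sub>R x) y = r *\<^sub>R tens x y"
  by (simp add: scaleR_scaleC tens_scaleC_left)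

lemma tens_scaleR_right: "tens x (r *\<^sub>R y) = r *\<^sub>R tens x y"
  by (simp add: scaleR_scaleC tens_scaleC_right)

lemma tens_zero [simp]: "tens 0 y = 0" "tens x 0 = 0"
  using tens_scaleR_left[of 0] tens_scaleR_right[of _ 0] by simp_all

lemma tens_sum_left: "tens (\<Sum>i\<in>I. f i) y = (\<Sum>i\<in>I. tens (f i) y)"
  by (induction I rule: infinite_finite_induct) (simp_all add: tens_add_left)

lemma norm_tens: "norm (tens x y) = norm x * norm y"
proof -
  have "(norm (tens x y))\<^sup>2 = (norm x * norm y)\<^sup>2"
    by (rule norm_power2_eqI, unfold cinner_tens) (simp add: cinner_norm power_mult_distrib)
  then show ?thesis by (simp add: power2_eq_iff_nonneg)
qed

lemma bounded_linear_tens: "bounded_linear (tens x)"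
  by (rule bounded_linear_intro[where K = "norm x"])
    (simp_all add: tens_add_right tens_scaleR_right norm_tens)

lemma tens_ext:
  assumes "\<And>x y. norm x = 1 \<Longrightarrow> cinner (tens x y) a = cinner (tens x y) b"
  shows "a = b"
proof (rule cinner_ext_dense[OF dense])
  fix z assume "z \<in> complex_space.span {tens x y | x y. True}"
  then show "cinner z a = cinner z b"
  proof (induction rule: complex_space.span_induct_alt)
    case (step c t w)
    then obtain x y where t: "t = tens x y" by blast
    have "cinner t a = cinner t b"
    proof (cases "x = 0")
      case False
      then have "t = norm x *\<^sub>R tens ((1 / norm x) *\<^sub>R x) y" by (simp add: t tens_scaleR_left)
      then show ?thesis
        using assms[of "(1 / norm x) *\<^sub>R x" y] False by (simp only: cinner_scaleR_left) simp
    qed (simp add: t)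
    then show ?case using step.IH by (simp add: cinner_add_left cinner_scaleC_left)
  qed simp
qed

text \<open>As \<open>e\<close> is a unit vector, \<open>tens e\<close> maps K isometrically onto a
  closed subspace; the vector sought is the preimage of the projection of \<open>x\<close> onto it.
  So the slice is the adjoint of \<open>tens e\<close>, obtained pointwise.\<close>

lemma slice_exists:
  assumes e: "norm e = 1"
  shows "\<exists>k. \<forall>k'. cinner k' k = cinner (tens e k') x"
proof -
  have lim: "l \<in> range (tens e)" if l: "\<forall>n. Y n \<in> range (tens e)" "Y \<longlonglongrightarrow> l" for Y l
  proof -
    have "\<forall>n. \<exists>k. Y n = tens e k" using l(1) by blast
    then obtain k where k: "\<And>n. Y n = tens e (k n)" by metis
    have "tens e a - tens e b = tens e (a - b)" for a b
      by (rule linear_diff[OF bounded_linear.linear[OF bounded_linear_tens], symmetric])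
    then have "dist (k m) (k n) = dist (Y m) (Y n)" for m n
      using e by (simp add: k dist_norm norm_tens)
    then have "Cauchy k" using LIMSEQ_imp_Cauchy[OF l(2)] by (simp add: Cauchy_def)
    then obtain k0 where "k \<longlonglongrightarrow> k0" using Cauchy_convergent convergent_def by blast
    then have "Y \<longlonglongrightarrow> tens e k0"
      unfolding k[abs_def] by (rule bounded_linear.tendsto[OF bounded_linear_tens])
    then show ?thesis using LIMSEQ_unique[OF l(2)] by blast
  qed
  have "complex_space.subspace (range (tens e))"
  proof (rule complex_space.subspaceI)
    show "0 \<in> range (tens e)" by (rule image_eqI[of _ _ 0]) simp_all
    fix x y assume "x \<in> range (tens e)" "y \<in> range (tens e)"
    then show "x + y \<in> range (tens e)" by (auto simp flip: tens_add_right)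
  next
    fix c x assume "x \<in> range (tens e)"
    then show "c *\<^sub>C x \<in> range (tens e)" by (auto simp flip: tens_scaleC_right)
  qed
  moreover have "closed (range (tens e))" unfolding closed_sequential_limits using lim by blast
  ultimately obtain k where "\<And>z. z \<in> range (tens e) \<Longrightarrow> cinner z (x - tens e k) = 0"
    using orthogonal_projection_exists by blast
  then have "cinner k' k = cinner (tens e k') x" for k'
    using e by (simp add: cinner_diff_right cinner_tens cinner_norm)
  then show ?thesis by blast
qed

definition slice :: "'h \<Rightarrow> 'l \<Rightarrow> 'k" where
  "slice e x = (SOME k. \<forall>k'. cinner k' k = cinner (tens e k') x)"

lemma cinner_slice: "norm e = 1 \<Longrightarrow> cinner k (slice e x) = cinner (tens e k) x"
  unfolding slice_def using someI_ex[OF slice_exists] by blast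

lemma slice_tens: "norm e = 1 \<Longrightarrow> slice e (tens x y) = cinner e x *\<^sub>C y"
  by (rule cinner_ext) (simp add: cinner_slice cinner_tens cinner_scaleC_right)

lemma slice_add: "norm e = 1 \<Longrightarrow> slice e (x + y) = slice e x + slice e y"
  by (rule cinner_ext) (simp add: cinner_slice cinner_add_right)

lemma slice_scaleC: "norm e = 1 \<Longrightarrow> slice e (c *\<^sub>C x) = c *\<^sub>C slice e x"
  by (rule cinner_ext) (simp add: cinner_slice cinner_scaleC_right)

lemma slice_diff: "norm e = 1 \<Longrightarrow> slice e (x - y) = slice e x - slice e y"
  by (rule cinner_ext) (simp add: cinner_slice cinner_diff_right)

lemma norm_slice: "norm e = 1 \<Longrightarrow> norm (slice e x) \<le> norm x"
  using cinner_cauchy_schwarz[of "tens e _" x]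
  by (intro norm_le_cinner) (simp_all add: cinner_slice norm_tens mult.commute)

lemma bounded_linear_slice: "norm e = 1 \<Longrightarrow> bounded_linear (slice e)"
  by (rule bounded_linear_intro[where K = 1])
    (simp_all add: slice_add slice_scaleC scaleR_scaleC norm_slice)

lemma compression_exists:
  assumes e: "norm e = 1" and T: "T \<in> bounded_ops"
  obtains B where "B \<in> bounded_ops"
    "\<And>y z. cinner y (blinfun_apply B z) = cinner (tens e y) (blinfun_apply T (tens e z))"
proof -
  define B where "B = Blinfun (\<lambda>z. slice e (T (tens e z)))"
  have B: "B z = slice e (T (tens e z))" for z
    unfolding B_def
    by (subst bounded_linear_Blinfun_apply)
      (rule bounded_linear_compose[OF bounded_linear_slice[OF e]]
        bounded_linear_compose[OF blinfun.bounded_linear_right] bounded_linear_tens refl)+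
  have "B \<in> bounded_ops"
    using T e by (simp add: bounded_ops_def B tens_scaleC_right slice_scaleC)
  then show ?thesis using that B cinner_slice[OF e] by simp
qed

section \<open>Expansions over finite orthonormal systems of H\<close>

lemma span_tens_expansion:
  assumes "x \<in> complex_space.span {tens x y | x y. True}"
  shows "\<exists>B. finite B \<and> (\<forall>F. finite F \<longrightarrow> (\<forall>b\<in>B. b = (\<Sum>f\<in>F. cinner f b *\<^sub>C f))
    \<longrightarrow> (\<exists>y. x = (\<Sum>f\<in>F. tens f (y f))))"
  using assms
proof (induction rule: complex_space.span_induct_alt)
  case base
  show ?case by (intro exI[of _ "{}"]) (auto intro!: exI[of _ "\<lambda>_. 0"])
next
  case (step c t w)
  then obtain a k where t: "t = tens a k" by blast
  from step.IH obtain B where B: "finite B"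
      "\<And>F. finite F \<Longrightarrow> \<forall>b\<in>B. b = (\<Sum>f\<in>F. cinner f b *\<^sub>C f) \<Longrightarrow> \<exists>y. w = (\<Sum>f\<in>F. tens f (y f))"
    by blast
  \<comment> \<open>The set \<open>B\<close> collects the left factors. The claim covers every
    \<open>F\<close> that expands them, so that two tensors can share one system.\<close>
  show ?case
  proof (intro exI[of _ "insert a B"] conjI allI impI)
    show "finite (insert a B)" using B(1) by simp
    fix F assume F: "finite F" "\<forall>b\<in>insert a B. b = (\<Sum>f\<in>F. cinner f b *\<^sub>C f)"
    then obtain y where y: "w = (\<Sum>f\<in>F. tens f (y f))" using B(2)[of F] by blast
    have "tens a k = (\<Sum>f\<in>F. tens f (cinner f a *\<^sub>C k))"
    proof -
      have "tens a k = tens (\<Sum>f\<in>F. cinner f a *\<^sub>C f) k" using F(2) by (intro arg_cong2[of _ _ _ _ tens]) auto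
      then show ?thesis by (simp add: tens_sum_left tens_scaleC_left tens_scaleC_right)
    qed
    then have "c *\<^sub>C t + w = (\<Sum>f\<in>F. tens f (c *\<^sub>C cinner f a *\<^sub>C k + y f))"
      by (simp only: t y complex_space.scale_sum_right tens_add_right tens_scaleC_right sum.distrib)
    then show "\<exists>y. c *\<^sub>C t + w = (\<Sum>f\<in>F. tens f (y f))" 
      by (rule exI[of _ "\<lambda>f. c *\<^sub>C cinner f a *\<^sub>C k + y f"])
  qed
qed

lemma common_expansion:
  assumes "x \<in> complex_space.span {tens x y | x y. True}" "z \<in> complex_space.span {tens x y | x y. True}"
    and e: "norm e = 1"
  obtains F y w where "finite F" "orthonormal F" "e \<in> F"
    "x = (\<Sum>f\<in>F. tens f (y f))" "z = (\<Sum>f\<in>F. tens f (w f))"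
proof -
  obtain B1 where B1: "finite B1"
      "\<And>F. finite F \<Longrightarrow> \<forall>b\<in>B1. b = (\<Sum>f\<in>F. cinner f b *\<^sub>C f) \<Longrightarrow> \<exists>y. x = (\<Sum>f\<in>F. tens f (y f))"
    using span_tens_expansion[OF assms(1)] by blast
  obtain B2 where B2: "finite B2"
      "\<And>F. finite F \<Longrightarrow> \<forall>b\<in>B2. b = (\<Sum>f\<in>F. cinner f b *\<^sub>C f) \<Longrightarrow> \<exists>y. z = (\<Sum>f\<in>F. tens f (y f))"
    using span_tens_expansion[OF assms(2)] by blast
  have "orthonormal {e}" using e by (simp add: orthonormal_def cinner_norm)
  then obtain F where F: "finite F" "orthonormal F" "{e} \<subseteq> F"
      "\<forall>b\<in>B1 \<union> B2. b = (\<Sum>f\<in>F. cinner f b *\<^sub>C f)"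
    using gram_schmidt_extend[of "B1 \<union> B2" "{e}"] B1(1) B2(1) by auto
  then show ?thesis using that B1(2)[of F] B2(2)[of F] by blast
qed

lemma cinner_expansion:
  assumes "finite F" "orthonormal F"
  shows "cinner (\<Sum>f\<in>F. tens f (y f)) (\<Sum>f\<in>F. tens f (w f)) = (\<Sum>f\<in>F. cinner (y f) (w f))"
proof -
  have "cinner (\<Sum>f\<in>F. tens f (y f)) (\<Sum>f\<in>F. tens f (w f))
      = (\<Sum>f\<in>F. \<Sum>g\<in>F. if f = g then cinner (y f) (w f) else 0)"
    unfolding cinner_sum_left cinner_sum_right cinner_tens
    by (intro sum.cong) (auto simp: orthonormal_cinner[OF assms(2)])
  then show ?thesis using assms(1) by simp
qed

lemma norm_expansion:
  assumes "finite F" "orthonormal F"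
  shows "norm (\<Sum>f\<in>F. tens f (y f)) = L2_set (\<lambda>f. norm (y f)) F"
proof -
  have "(norm (\<Sum>f\<in>F. tens f (y f)))\<^sup>2 = (\<Sum>f\<in>F. (norm (y f))\<^sup>2)"
    by (rule norm_power2_eqI, unfold cinner_expansion[OF assms]) (simp add: cinner_norm)
  then show ?thesis unfolding L2_set_def by (metis norm_ge_zero real_sqrt_unique)
qed

text \<open>The operator \<open>I \<otimes> B\<close> is first obtained on the algebraic tensor product and
  then extended by continuity; slices determine its values uniquely.\<close>

lemma ampliation_exists:
  assumes B: "B \<in> bounded_ops"
  obtains X where "X \<in> bounded_ops" "\<And>x y. blinfun_apply X (tens x y) = tens x (blinfun_apply B y)"
    "norm X \<le> norm B"
proof -
  \<comment> \<open>The graph of the operator sought: every slice of \<open>x'\<close> is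
    \<open>B\<close> applied to the slice of \<open>x\<close>. It is linear, and single-valued
    because slices separate points; existence and the norm bound remain.\<close>
  define R where "R x x' \<longleftrightarrow> (\<forall>e. norm e = 1 \<longrightarrow> (\<forall>k. cinner (tens e k) x' = cinner k (B (slice e x))))" for x x'
  have unique: "a = b" if "R x a" "R x b" for x a b
    using that unfolding R_def by (intro tens_ext) simp
  have R_add: "R (x + y) (a + b)" if "R x a" "R y b" for x y a b
    using that unfolding R_def by (simp add: slice_add blinfun.add_right cinner_add_right)
  have R_diff: "R (x - y) (a - b)" if "R x a" "R y b" for x y a b
    using that unfolding R_def by (simp add: slice_diff blinfun.diff_right cinner_diff_right)
  have R_scaleC: "R (c *\<^sub>C x) (c *\<^sub>C a)" if "R x a" for c x a
    using that unfolding R_def by (simp add: slice_scaleC bounded_ops_scaleC[OF B] cinner_scaleC_right)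
  have R_tens: "R (tens x y) (tens x (B y))" for x y
    unfolding R_def by (simp add: slice_tens bounded_ops_scaleC[OF B] cinner_tens cinner_scaleC_right)
  have R_sum: "R (\<Sum>f\<in>F. tens f (y f)) (\<Sum>f\<in>F. tens f (B (y f)))" if "finite F" for F y
    using that
  proof (induction F rule: finite_induct)
    case empty
    show ?case using R_tens[of 0 0] by simp
  qed (simp add: R_add R_tens)
  let ?D = "complex_space.span {tens x y | x y. True}"
  have on_D: "\<exists>a. R x a \<and> norm a \<le> norm B * norm x" if x: "x \<in> ?D" for x
  proof (cases "\<exists>e :: 'h. norm e = 1")
    case True
    then obtain e :: 'h where "norm e = 1" by blast
    then obtain F y where F: "finite F" "orthonormal F" "x = (\<Sum>f\<in>F. tens f (y f))"
      using common_expansion[OF x x] by metis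
    \<comment> \<open>Over an orthonormal system the norm is the l2 norm of the fibres, on which
      \<open>B\<close> acts separately.\<close>
    have "L2_set (\<lambda>f. norm (B (y f))) F \<le> L2_set (\<lambda>f. norm B * norm (y f)) F"
      by (intro L2_set_mono norm_blinfun) simp
    also have "\<dots> = norm B * L2_set (\<lambda>f. norm (y f)) F" by (simp add: L2_set_right_distrib)
    finally show ?thesis
      using R_sum[OF F(1), of y] norm_expansion[OF F(1,2)] F(3)
      by (intro exI[of _ "\<Sum>f\<in>F. tens f (B (y f))"]) auto
  next
    case False
    then have "R x 0" by (simp add: R_def)
    then show ?thesis by (intro exI[of _ 0]) simp
  qed
  have total: "\<exists>a. R x a \<and> norm a \<le> norm B * norm x" for x
  proof -
    obtain X where X: "\<And>n. X n \<in> ?D" "X \<longlonglongrightarrow> x"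
      using dense unfolding closure_sequential by (metis UNIV_I closure_sequential)
    obtain a where a: "\<And>n. R (X n) (a n)" "\<And>n. norm (a n) \<le> norm B * norm (X n)"
      using on_D[OF X(1)] by metis
    have diff: "dist (a m) (a n) \<le> norm B * dist (X m) (X n)" for m n
    proof -
      obtain c where "R (X m - X n) c" "norm c \<le> norm B * norm (X m - X n)"
        using on_D[OF complex_space.span_diff[OF X(1) X(1)]] by blast
      then show ?thesis using unique[OF R_diff[OF a(1) a(1)]] by (simp add: dist_norm)
    qed
    have "Cauchy a"
    proof (rule metric_CauchyI)
      fix e :: real assume "0 < e"
      then have "0 < e / (norm B + 1)" by (simp add: add_nonneg_pos)
      then obtain M where M: "\<And>m n. m \<ge> M \<Longrightarrow> n \<ge> M \<Longrightarrow> dist (X m) (X n) < e / (norm B + 1)"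
        using LIMSEQ_imp_Cauchy[OF X(2)] unfolding Cauchy_def by blast
      have "dist (a m) (a n) < e" if "m \<ge> M" "n \<ge> M" for m n
      proof -
        have "dist (a m) (a n) \<le> (norm B + 1) * dist (X m) (X n)"
          using diff[of m n] by (simp add: distrib_right add_increasing2)
        also have "\<dots> < (norm B + 1) * (e / (norm B + 1))"
          using M[OF that] by (intro mult_strict_left_mono) (auto simp: add_nonneg_pos)
        also have "\<dots> = e" using norm_ge_zero[of B] by (simp add: add_nonneg_eq_0_iff)
        finally show ?thesis .
      qed
      then show "\<exists>M. \<forall>m\<ge>M. \<forall>n\<ge>M. dist (a m) (a n) < e" by blast
    qed
    then obtain a0 where a0: "a \<longlonglongrightarrow> a0" using Cauchy_convergent convergent_def by blast
    have "R x a0" unfolding R_def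
    proof (intro allI impI)
      fix e :: 'h and k assume e: "norm e = 1"
      have "(\<lambda>n. cinner (tens e k) (a n)) \<longlonglongrightarrow> cinner (tens e k) a0"
        by (rule tendsto_cinner_right[OF a0])
      moreover have "(\<lambda>n. cinner k (B (slice e (X n)))) \<longlonglongrightarrow> cinner k (B (slice e x))"
        by (intro tendsto_cinner_right blinfun.tendsto tendsto_const
            bounded_linear.tendsto[OF bounded_linear_slice[OF e]] X(2))
      moreover have "cinner (tens e k) (a n) = cinner k (B (slice e (X n)))" for n
        using a(1) e by (simp add: R_def)
      ultimately show "cinner (tens e k) a0 = cinner k (B (slice e x))"
        by (simp add: LIMSEQ_unique)
    qed
    moreover have "norm a0 \<le> norm B * norm x"
      using a(2) by (intro LIMSEQ_le[OF tendsto_norm[OF a0] tendsto_mult[OF tendsto_const tendsto_norm[OF X(2)]]]) auto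
    ultimately show ?thesis by blast
  qed
  then obtain g where g: "\<And>x. R x (g x)" "\<And>x. norm (g x) \<le> norm B * norm x" by metis
  have g_scaleC: "g (c *\<^sub>C x) = c *\<^sub>C g x" for c x
    by (rule unique[OF g(1) R_scaleC[OF g(1)]])
  have "bounded_linear g"
    by (rule bounded_linear_intro[where K = "norm B"])
      (use unique[OF g(1) R_add[OF g(1) g(1)]] g(2) in \<open>auto simp: scaleR_scaleC g_scaleC mult.commute\<close>)
  then have X: "blinfun_apply (Blinfun g) = g" by (rule bounded_linear_Blinfun_apply)
  show ?thesis
  proof (rule that[of "Blinfun g"])
    show "Blinfun g \<in> bounded_ops" by (simp add: bounded_ops_def X g_scaleC)
    show "blinfun_apply (Blinfun g) (tens x y) = tens x (B y)" for x y
      using unique[OF g(1) R_tens] by (simp add: X)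
    show "norm (Blinfun g) \<le> norm B" by (rule norm_blinfun_bound) (simp_all add: X g(2))
  qed
qed

section \<open>The algebra \<open>\<complex>I \<otimes> B(K)\<close>\<close>

definition ampliations :: "('l \<Rightarrow>\<^sub>L 'l) set" where
  "ampliations = {X \<in> bounded_ops. \<exists>B\<in>bounded_ops. \<forall>x y. X (tens x y) = tens x (B y)}"

text \<open>The scalar in the first factor can be absorbed into the operator on K.\<close>

lemma ampliations_elementary: "elementary_op_tensors tens scalar_ops bounded_ops = ampliations"
proof (intro set_eqI iffI)
  fix X assume "X \<in> elementary_op_tensors tens scalar_ops bounded_ops"
  then obtain c B where X: "X \<in> bounded_ops" "B \<in> bounded_ops" "\<And>x y. X (tens x y) = tens (c *\<^sub>C x) (B y)"
    by (auto simp: elementary_op_tensors_def scalar_ops_def scalar_op_apply)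
  then have "X (tens x y) = tens x (op_scaleC c B y)" for x y
    by (simp add: op_scaleC_apply tens_scaleC_left tens_scaleC_right)
  with X show "X \<in> ampliations" unfolding ampliations_def by (blast intro: bounded_ops_op_scaleC)
next
  fix X assume "X \<in> ampliations"
  then obtain B where X: "X \<in> bounded_ops" "B \<in> bounded_ops" "\<And>x y. X (tens x y) = tens x (B y)"
    by (auto simp: ampliations_def)
  have "op_scaleC 1 id_blinfun \<in> (scalar_ops :: ('h \<Rightarrow>\<^sub>L 'h) set)"
    unfolding scalar_ops_def by blast
  moreover have "X (tens x y) = tens (op_scaleC 1 id_blinfun x) (B y)" for x y
    by (simp add: X(3))
  ultimately show "X \<in> elementary_op_tensors tens scalar_ops bounded_ops"
    unfolding elementary_op_tensors_def using X(1,2) by blast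
qed

text \<open>The operator on K is recovered as the compression at \<open>e\<close>. This trades the
  existential quantifier for equations between coefficients, which are closed in the weak operator
  topology.\<close>

lemma ampliations_iff:
  assumes e: "norm e = 1"
  shows "X \<in> ampliations \<longleftrightarrow> X \<in> bounded_ops \<and> (\<forall>x x' y y'.
    cinner (tens x y) (X (tens x' y')) = cinner x x' * cinner (tens e y) (X (tens e y')))"
proof
  assume "X \<in> ampliations"
  then show "X \<in> bounded_ops \<and> (\<forall>x x' y y'.
      cinner (tens x y) (X (tens x' y')) = cinner x x' * cinner (tens e y) (X (tens e y')))"
    using e by (auto simp: ampliations_def cinner_tens cinner_norm)
next
  assume R: "X \<in> bounded_ops \<and> (\<forall>x x' y y'.
      cinner (tens x y) (X (tens x' y')) = cinner x x' * cinner (tens e y) (X (tens e y')))"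
  then obtain B where B: "B \<in> bounded_ops"
      "\<And>y z. cinner y (B z) = cinner (tens e y) (X (tens e z))"
    using compression_exists[OF e] by blast
  have "X (tens x y) = tens x (B y)" for x y
  proof (rule tens_ext)
    fix x' y'
    show "cinner (tens x' y') (X (tens x y)) = cinner (tens x' y') (tens x (B y))"
      unfolding cinner_tens B(2) using R by blast
  qed
  then show "X \<in> ampliations" using R B(1) by (auto simp: ampliations_def)
qed

lemma subspace_ampliations: "op_space.subspace ampliations"
proof (rule op_space.subspaceI)
  show "0 \<in> ampliations"
    unfolding ampliations_def by (auto simp: bounded_ops_def intro!: exI[of _ 0])
next
  fix X Y assume "X \<in> ampliations" "Y \<in> ampliations"
  then obtain A B where "X \<in> bounded_ops" "A \<in> bounded_ops" "\<And>x y. X (tens x y) = tens x (A y)"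
      "Y \<in> bounded_ops" "B \<in> bounded_ops" "\<And>x y. Y (tens x y) = tens x (B y)"
    by (auto simp: ampliations_def)
  then have "X + Y \<in> bounded_ops \<and> A + B \<in> bounded_ops \<and> (\<forall>x y. (X + Y) (tens x y) = tens x ((A + B) y))"
    by (auto simp: bounded_ops_def blinfun.add_left scaleC_add_right tens_add_right)
  then show "X + Y \<in> ampliations" unfolding ampliations_def by blast
next
  fix c X assume "X \<in> ampliations"
  then obtain A where "X \<in> bounded_ops" "A \<in> bounded_ops" "\<And>x y. X (tens x y) = tens x (A y)"
    by (auto simp: ampliations_def)
  then have "op_scaleC c X \<in> bounded_ops \<and> op_scaleC c A \<in> bounded_ops \<and>
      (\<forall>x y. op_scaleC c X (tens x y) = tens x (op_scaleC c A y))"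
    by (auto simp: bounded_ops_op_scaleC op_scaleC_apply tens_scaleC_right)
  then show "op_scaleC c X \<in> ampliations" unfolding ampliations_def by blast
qed

lemma closedin_wot_ampliations:
  assumes e: "norm (e :: 'h) = 1"
  shows "closedin weak_operator_topology ampliations"
proof -
  have "ampliations = bounded_ops \<inter> {X. \<forall>i :: 'h \<times> 'h \<times> 'k \<times> 'k.
      cinner (tens (fst i) (fst (snd (snd i)))) (blinfun_apply X (tens (fst (snd i)) (snd (snd (snd i)))))
      = cinner (cnj (cinner (fst i) (fst (snd i))) *\<^sub>C tens e (fst (snd (snd i)))) (blinfun_apply X (tens e (snd (snd (snd i)))))}"
    by (simp add: ampliations_iff[OF e] cinner_scaleC_left set_eq_iff split_paired_All)
  then show ?thesis
    by (simp only: closedin_Int closedin_wot_bounded_ops closedin_wot_coefficient_eqs)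
qed

lemma wot_tensor_scalar_ops:
  assumes e: "norm (e :: 'h) = 1"
  shows "wot_tensor tens scalar_ops bounded_ops = ampliations"
proof -
  have "spatial_tensor tens scalar_ops bounded_ops = ampliations"
    unfolding spatial_tensor_def ampliations_elementary
    using op_space.span_eq_iff[THEN iffD2, OF subspace_ampliations]
      closedin_wot_imp_closed[OF closedin_wot_ampliations[OF e]] by (simp only: closure_closed)
  then show ?thesis
    unfolding wot_tensor_def using closedin_wot_ampliations[OF e] by (simp add: closure_of_closedin)
qed

lemma cinner_ampliation_expansion:
  assumes "finite F" "orthonormal F" "\<And>x y. blinfun_apply X (tens x y) = tens x (blinfun_apply B y)"
  shows "cinner (\<Sum>f\<in>F. tens f (y f)) (X (\<Sum>f\<in>F. tens f (w f))) = (\<Sum>f\<in>F. cinner (y f) (B (w f)))"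
  using cinner_expansion[OF assms(1,2), of y "\<lambda>f. B (w f)"]
  by (simp add: blinfun.sum_right assms(3))

end

section \<open>Complete hyperreflexivity\<close>

lemma cauchy_schwarz_two:
  fixes a b c d p q :: real
  assumes "a\<^sup>2 + c\<^sup>2 = p\<^sup>2" "b\<^sup>2 + d\<^sup>2 = q\<^sup>2" "0 \<le> p" "0 \<le> q"
  shows "a * b + c * d \<le> p * q"
proof (rule power2_le_imp_le)
  \<comment> \<open>Lagrange's identity.\<close>
  have "(a * b + c * d)\<^sup>2 + (a * d - c * b)\<^sup>2 = (a\<^sup>2 + c\<^sup>2) * (b\<^sup>2 + d\<^sup>2)"
    by (simp add: power2_eq_square algebra_simps)
  then show "(a * b + c * d)\<^sup>2 \<le> (p * q)\<^sup>2"
    using zero_le_power2[of "a * d - c * b"] unfolding assms power_mult_distrib by linarith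
qed (use assms in simp)

text \<open>Here \<open>x'\<close>, \<open>z'\<close> are the images of \<open>x\<close>, \<open>z\<close> under a self-adjoint unitary \<open>U\<close> commuting with \<open>S\<close>;
  the difference of the two coefficients is split along the spectral projections \<open>(1 \<plusminus> U) / 2\<close>.\<close>

lemma symmetry_le_beta:
  fixes S :: "('a::complex_hilbert \<Rightarrow>\<^sub>L 'a) set" and T :: "'a \<Rightarrow>\<^sub>L 'a"
  assumes S: "op_space.subspace S" and "norm (x0 :: 'a) = 1"
    and same: "\<And>A. A \<in> S \<Longrightarrow> cinner x (A z) = cinner x' (A z')"
    and cross: "\<And>A. A \<in> S \<Longrightarrow> cinner x (A z') = cinner x' (A z)"
    and n: "norm x' = norm x" "norm z' = norm z"
  shows "cmod (cinner x (T z) - cinner x' (T z')) \<le> 2 * beta S T * (norm x * norm z)"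
proof -
  have \<beta>: "0 \<le> beta S T" using beta_nonneg[OF S assms(2)] .
  have expand: "cinner (x + x') (A (z - z')) = cinner x (A z) - cinner x (A z') + cinner x' (A z) - cinner x' (A z')"
      "cinner (x - x') (A (z + z')) = cinner x (A z) + cinner x (A z') - cinner x' (A z) - cinner x' (A z')"
    for A :: "'a \<Rightarrow>\<^sub>L 'a"
    by (simp_all add: blinfun.add_right blinfun.diff_right cinner_algebra)
  \<comment> \<open>By \<open>same\<close> and \<open>cross\<close> the four coefficients in
    \<open>expand\<close> cancel for \<open>A\<close> in \<open>S\<close>, so both pairs of vectors
    are admissible in \<beta>.\<close>
  have 1: "cmod (cinner (x + x') (T (z - z'))) \<le> beta S T * norm (x + x') * norm (z - z')"
    by (rule cinner_le_beta[OF S]) (simp only: expand, simp add: same cross)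
  have 2: "cmod (cinner (x - x') (T (z + z'))) \<le> beta S T * norm (x - x') * norm (z + z')"
    by (rule cinner_le_beta[OF S]) (simp only: expand, simp add: same cross)
  have "cinner (x + x') (T (z - z')) + cinner (x - x') (T (z + z')) = 2 * (cinner x (T z) - cinner x' (T z'))"
    by (simp only: expand) simp
  then have "2 * cmod (cinner x (T z) - cinner x' (T z'))
      = cmod (cinner (x + x') (T (z - z')) + cinner (x - x') (T (z + z')))"
    by (simp only: norm_mult) simp
  also have "\<dots> \<le> cmod (cinner (x + x') (T (z - z'))) + cmod (cinner (x - x') (T (z + z')))"
    by (rule norm_triangle_ineq)
  also have "\<dots> \<le> beta S T * (norm (x + x') * norm (z - z') + norm (x - x') * norm (z + z'))"
    using 1 2 by (simp add: algebra_simps)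
  \<comment> \<open>Bounding the two products separately would double the constant; the
    parallelogram law lets Cauchy-Schwarz treat them together.\<close>
  also have "\<dots> \<le> beta S T * ((2 * norm x) * (2 * norm z))"
    using parallelogram_law[of x x'] parallelogram_law[of z z'] n
    by (intro mult_left_mono[OF _ \<beta>] cauchy_schwarz_two) (auto simp: power_mult_distrib)
  finally show ?thesis by (simp add: mult_ac)
qed

text \<open>Orthogonality of characters: a subset \<open>s\<close> stands for the signs that are 1
  on \<open>s\<close> and -1 elsewhere. For distinct \<open>f\<close> and \<open>g\<close>, toggling
  the membership of \<open>f\<close> reverses every term.\<close>

lemma sum_sign_characters:
  assumes F: "finite F" "f \<in> F" "g \<in> F"
  shows "(\<Sum>s\<in>Pow F. (if f \<in> s then 1 else -1) * (if g \<in> s then 1 else -1))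
    = (if f = g then 2 ^ card F else (0 :: real))"
proof (cases "f = g")
  case True
  have "(\<Sum>s\<in>Pow F. (if f \<in> s then 1 else -1) * (if g \<in> s then 1 else -1)) = (\<Sum>s\<in>Pow F. (1 :: real))"
    using True by (intro sum.cong) auto
  then show ?thesis using True F(1) by (simp add: card_Pow)
next
  case False
  let ?h = "\<lambda>s. (if f \<in> s then 1 else -1) * (if g \<in> s then 1 else -1 :: real)"
  let ?flip = "\<lambda>s. if f \<in> s then s - {f} else insert f s"
  have "sum ?h (Pow F) = (\<Sum>s\<in>Pow F. - ?h s)"
    by (rule sum.reindex_bij_witness[of _ ?flip ?flip]) (use F False in \<open>auto split: if_splits\<close>)
  then show ?thesis using False by (simp add: sum_negf)
qed

context tensor_product
begin

text \<open>Averaging over all sign changes of the orthonormal system kills the off-diagonal coefficients.\<close>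

lemma diagonal_le_beta:
  fixes T :: "'l \<Rightarrow>\<^sub>L 'l"
  assumes F: "finite F" "orthonormal F" and x0: "norm (x0 :: 'l) = 1"
  shows "cmod (cinner (\<Sum>f\<in>F. tens f (y f)) (T (\<Sum>f\<in>F. tens f (w f)))
      - (\<Sum>f\<in>F. cinner (tens f (y f)) (T (tens f (w f)))))
    \<le> 2 * beta ampliations T * (norm (\<Sum>f\<in>F. tens f (y f)) * norm (\<Sum>f\<in>F. tens f (w f)))"
proof -
  define \<epsilon> where "\<epsilon> s f = (if f \<in> s then 1 else -1 :: real)" for s and f :: 'h
  have \<epsilon>: "\<epsilon> s f * \<epsilon> s f = 1" "\<bar>\<epsilon> s f\<bar> = 1" for s f by (auto simp: \<epsilon>_def)
  define x z where "x = (\<Sum>f\<in>F. tens f (y f))" and "z = (\<Sum>f\<in>F. tens f (w f))"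
  define xs zs where "xs s = (\<Sum>f\<in>F. tens f (\<epsilon> s f *\<^sub>R y f))" and "zs s = (\<Sum>f\<in>F. tens f (\<epsilon> s f *\<^sub>R w f))" for s
  define t where "t f g = cinner (tens f (y f)) (T (tens g (w g)))" for f g
  define b where "b = 2 * beta ampliations T * (norm x * norm z)"
  have step: "cmod (cinner x (T z) - cinner (xs s) (T (zs s))) \<le> b" for s
    unfolding b_def
  proof (rule symmetry_le_beta[OF subspace_ampliations x0])
    fix A assume "A \<in> ampliations"
    then obtain B where B: "\<And>x y. A (tens x y) = tens x (blinfun_apply B y)" by (auto simp: ampliations_def)
    note exp = cinner_ampliation_expansion[OF F B]
    have \<epsilon>_cancel: "complex_of_real (\<epsilon> s f) * (of_real (\<epsilon> s f) * c) = c" for f c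
      by (simp add: \<epsilon>(1) flip: mult.assoc of_real_mult)
    show "cinner x (A z) = cinner (xs s) (A (zs s))"
      unfolding x_def z_def xs_def zs_def exp
      by (simp only: blinfun.scaleR_right cinner_scaleR_left cinner_scaleR_right \<epsilon>_cancel)
    show "cinner x (A (zs s)) = cinner (xs s) (A z)"
      unfolding x_def z_def xs_def zs_def exp
      by (simp add: blinfun.scaleR_right cinner_scaleR_left cinner_scaleR_right)
  next
    show "norm (xs s) = norm x" "norm (zs s) = norm z"
      unfolding x_def z_def xs_def zs_def norm_expansion[OF F] by (simp_all add: \<epsilon>(2))
  qed
  have coeff: "cinner (xs s) (T (zs s)) = (\<Sum>f\<in>F. \<Sum>g\<in>F. of_real (\<epsilon> s f * \<epsilon> s g) * t f g)" for s
    unfolding xs_def zs_def t_def tens_scaleR_right blinfun.sum_right blinfun.scaleR_right cinner_sum_left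
    by (simp add: cinner_sum_right cinner_scaleR_left cinner_scaleR_right mult_ac)
  have "(\<Sum>s\<in>Pow F. cinner (xs s) (T (zs s)))
      = (\<Sum>f\<in>F. \<Sum>g\<in>F. of_real (\<Sum>s\<in>Pow F. \<epsilon> s f * \<epsilon> s g) * t f g)"
  proof -
    have "(\<Sum>s\<in>Pow F. cinner (xs s) (T (zs s))) = (\<Sum>f\<in>F. \<Sum>s\<in>Pow F. \<Sum>g\<in>F. of_real (\<epsilon> s f * \<epsilon> s g) * t f g)"
      unfolding coeff by (rule sum.swap)
    also have "\<dots> = (\<Sum>f\<in>F. \<Sum>g\<in>F. \<Sum>s\<in>Pow F. of_real (\<epsilon> s f * \<epsilon> s g) * t f g)"
      by (intro sum.cong refl sum.swap)
    finally show ?thesis by (simp only: of_real_sum sum_distrib_right)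
  qed
  also have "\<dots> = (\<Sum>f\<in>F. \<Sum>g\<in>F. if f = g then 2 ^ card F * t f g else 0)"
    by (intro sum.cong refl) (simp add: sum_sign_characters[OF F(1)] \<epsilon>_def[abs_def])
  also have "\<dots> = 2 ^ card F * (\<Sum>f\<in>F. t f f)" using F(1) by (simp add: sum_distrib_left)
  finally have total: "(\<Sum>s\<in>Pow F. cinner (xs s) (T (zs s))) = 2 ^ card F * (\<Sum>f\<in>F. t f f)" .
  \<comment> \<open>The number of sign patterns appears on both sides, so the bound does not depend
    on the size of \<open>F\<close>.\<close>
  have "2 ^ card F * (cinner x (T z) - (\<Sum>f\<in>F. t f f)) = (\<Sum>s\<in>Pow F. cinner x (T z) - cinner (xs s) (T (zs s)))"
    using F(1) by (simp add: sum_subtractf total card_Pow right_diff_distrib)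
  then have "2 ^ card F * cmod (cinner x (T z) - (\<Sum>f\<in>F. t f f))
      = cmod (\<Sum>s\<in>Pow F. cinner x (T z) - cinner (xs s) (T (zs s)))"
    by (metis norm_mult norm_numeral norm_power)
  also have "\<dots> \<le> (\<Sum>s\<in>Pow F. b)" by (intro sum_norm_le step)
  also have "\<dots> = 2 ^ card F * b" using F(1) by (simp add: card_Pow)
  finally show ?thesis by (simp add: x_def z_def t_def b_def)
qed

text \<open>The symmetry is the exchange of \<open>e\<close> and \<open>f\<close>. Only its effect
  on two vectors enters, so it need not be constructed as an operator.\<close>

lemma exchange_le_beta:
  fixes T :: "'l \<Rightarrow>\<^sub>L 'l"
  assumes F: "orthonormal F" "f \<in> F" "e \<in> F" and x0: "norm (x0 :: 'l) = 1"
  shows "cmod (cinner (tens f y) (T (tens f w)) - cinner (tens e y) (T (tens e w)))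
    \<le> 2 * beta ampliations T * (norm y * norm w)"
proof -
  have n: "norm f = 1" "norm e = 1" using F orthonormal_norm by blast+
  have "cmod (cinner (tens f y) (T (tens f w)) - cinner (tens e y) (T (tens e w)))
      \<le> 2 * beta ampliations T * (norm (tens f y) * norm (tens f w))"
  proof (rule symmetry_le_beta[OF subspace_ampliations x0])
    fix A assume "A \<in> ampliations"
    then obtain B where B: "\<And>x y. A (tens x y) = tens x (blinfun_apply B y)" by (auto simp: ampliations_def)
    show "cinner (tens f y) (A (tens f w)) = cinner (tens e y) (A (tens e w))"
      "cinner (tens f y) (A (tens e w)) = cinner (tens e y) (A (tens f w))"
      using orthonormal_cinner[OF F(1)] F(2,3) by (auto simp: B cinner_tens)
  qed (simp_all add: norm_tens n)
  then show ?thesis by (simp add: norm_tens n)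
qed

lemma ampliation_near:
  fixes T :: "'l \<Rightarrow>\<^sub>L 'l"
  assumes T: "T \<in> bounded_ops" and e: "norm (e :: 'h) = 1" and x0: "norm (x0 :: 'l) = 1"
  shows "\<exists>X\<in>ampliations. norm (T - X) \<le> 4 * beta ampliations T"
proof -
  obtain B where B: "B \<in> bounded_ops" "\<And>y z. cinner y (blinfun_apply B z) = cinner (tens e y) (T (tens e z))"
    using compression_exists[OF e T] by blast
  obtain X where X: "X \<in> bounded_ops" "\<And>x y. blinfun_apply X (tens x y) = tens x (B y)"
    by (rule ampliation_exists[OF B(1)], rule that)
  define \<beta> where "\<beta> = beta ampliations T"
  have \<beta>: "0 \<le> \<beta>" unfolding \<beta>_def by (rule beta_nonneg[OF subspace_ampliations x0])
  let ?D = "complex_space.span {tens x y | x y. True}"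
  have core: "cmod (cinner x ((T - X) z)) \<le> 4 * \<beta> * norm z * norm x" if xz: "x \<in> ?D" "z \<in> ?D" for x z
  proof -
    obtain F y w where F: "finite F" "orthonormal F" "e \<in> F"
        and x: "x = (\<Sum>f\<in>F. tens f (y f))" and z: "z = (\<Sum>f\<in>F. tens f (w f))"
      using common_expansion[OF xz e] .
    define t where "t f = cinner (tens f (y f)) (T (tens f (w f)))" for f
    define c where "c f = cinner (tens e (y f)) (T (tens e (w f)))" for f
    have "cinner x (X z) = (\<Sum>f\<in>F. c f)"
      unfolding x z c_def cinner_ampliation_expansion[OF F(1,2) X(2)] B(2) ..
    then have "cinner x ((T - X) z) = (cinner x (T z) - (\<Sum>f\<in>F. t f)) + (\<Sum>f\<in>F. t f - c f)"
      by (simp add: blinfun.diff_left cinner_diff_right sum_subtractf)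
    also have "cmod \<dots> \<le> cmod (cinner x (T z) - (\<Sum>f\<in>F. t f)) + cmod (\<Sum>f\<in>F. t f - c f)"
      by (rule norm_triangle_ineq)
    also have "cmod (cinner x (T z) - (\<Sum>f\<in>F. t f)) \<le> 2 * \<beta> * (norm x * norm z)"
      unfolding x z t_def \<beta>_def by (rule diagonal_le_beta[OF F(1,2) x0])
    also have "cmod (\<Sum>f\<in>F. t f - c f) \<le> (\<Sum>f\<in>F. 2 * \<beta> * (norm (y f) * norm (w f)))"
      unfolding t_def c_def \<beta>_def by (intro sum_norm_le exchange_le_beta[OF F(2) _ F(3) x0])
    also have "\<dots> = 2 * \<beta> * (\<Sum>f\<in>F. \<bar>norm (y f)\<bar> * \<bar>norm (w f)\<bar>)" by (simp add: sum_distrib_left)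
    \<comment> \<open>Cauchy-Schwarz over \<open>F\<close> recombines the fibrewise bounds without a
      factor depending on \<open>F\<close>.\<close>
    also have "\<dots> \<le> 2 * \<beta> * (norm x * norm z)"
      unfolding x z norm_expansion[OF F(1,2)] using \<beta> by (intro mult_left_mono L2_set_mult_ineq) auto
    finally show ?thesis by (simp add: algebra_simps)
  qed
  \<comment> \<open>Density is used twice: here in the left vector, then in
    \<open>z\<close>.\<close>
  have "norm ((T - X) z) \<le> 4 * \<beta> * norm z" if z: "z \<in> ?D" for z
    by (rule norm_le_dense[OF dense]) (use core z \<beta> in auto)
  moreover have "closed {z. norm ((T - X) z) \<le> 4 * \<beta> * norm z}"
    by (intro closed_Collect_le continuous_intros)
  ultimately have "closure ?D \<subseteq> {z. norm ((T - X) z) \<le> 4 * \<beta> * norm z}"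
    by (intro closure_minimal) auto
  then have "norm (T - X) \<le> 4 * \<beta>"
    unfolding dense using \<beta> by (intro norm_blinfun_bound) auto
  moreover have "X \<in> ampliations" using X B(1) by (auto simp: ampliations_def)
  ultimately show ?thesis unfolding \<beta>_def by blast
qed

lemma hyperreflexive_with_ampliations:
  assumes e: "norm (e :: 'h) = 1" and x0: "norm (x0 :: 'l) = 1"
  shows "hyperreflexive_with ampliations 4"
  unfolding hyperreflexive_with_def
proof
  fix T :: "'l \<Rightarrow>\<^sub>L 'l" assume "T \<in> bounded_ops"
  from ampliation_near[OF this e x0] obtain X where "X \<in> ampliations" "norm (T - X) \<le> 4 * beta ampliations T"
    by blast
  then show "infdist T ampliations \<le> 4 * beta ampliations T"
    using infdist_le[of X ampliations T] by (simp add: dist_norm)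
qed

end

section \<open>The lower bound for the complete constant\<close>

definition rank_one :: "'a::complex_hilbert \<Rightarrow> 'a \<Rightarrow> 'a \<Rightarrow>\<^sub>L 'a" where
  "rank_one u v = Blinfun (\<lambda>x. cinner v x *\<^sub>C u)"

lemma rank_one_apply: "blinfun_apply (rank_one u v) x = cinner v x *\<^sub>C u"
  unfolding rank_one_def
proof (subst bounded_linear_Blinfun_apply)
  show "bounded_linear (\<lambda>x. cinner v x *\<^sub>C u)"
  proof (rule bounded_linear_intro[where K = "norm v * norm u"])
    show "norm (cinner v x *\<^sub>C u) \<le> norm x * (norm v * norm u)" for x
      using mult_right_mono[OF cinner_cauchy_schwarz[of v x] norm_ge_zero[of u]]
      by (simp add: norm_scaleC mult_ac)
    show "cinner v (r *\<^sub>R x) *\<^sub>C u = r *\<^sub>R (cinner v x *\<^sub>C u)" for r x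
      unfolding cinner_scaleR_right by (simp add: scaleR_scaleC scaleC_scaleC)
  qed (simp add: cinner_add_right scaleC_add_left)
qed simp

lemma rank_one_bounded_ops: "rank_one u v \<in> bounded_ops"
  by (simp add: bounded_ops_def rank_one_apply cinner_scaleC_right scaleC_scaleC)

lemma norm_rank_one: "norm (rank_one u v) \<le> norm v * norm u"
proof (rule norm_blinfun_bound)
  fix x
  show "norm (rank_one u v x) \<le> norm v * norm u * norm x"
    using mult_right_mono[OF cinner_cauchy_schwarz[of v x] norm_ge_zero[of u]]
    by (simp add: rank_one_apply norm_scaleC mult_ac)
qed simp

lemma bounded_ops_add: "S \<in> bounded_ops \<Longrightarrow> T \<in> bounded_ops \<Longrightarrow> S + T \<in> bounded_ops"
  by (simp add: bounded_ops_def blinfun.add_left scaleC_add_right)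

text \<open>Let \<open>W\<close> be the partial isometry
  \<open>e\<^sub>2 \<otimes> k\<^sub>1 \<mapsto> e\<^sub>2 \<otimes> k\<^sub>1\<close>, \<open>(e\<^sub>1 \<otimes> k\<^sub>1 + e\<^sub>2 \<otimes> k\<^sub>2) / \<surd>2 \<mapsto> - e\<^sub>1 \<otimes> k\<^sub>1\<close>. A functional annihilating
  \<open>I \<otimes> B(K)\<close> attains its norm at \<open>W\<close>, so the distance of \<open>W\<close> is 1. But no nonzero vector \<open>v\<close> of the
  initial space has \<open>W v\<close> orthogonal to \<open>(I \<otimes> B(K)) v\<close>, which keeps \<open>\<beta>(W)\<close> below 1.\<close>

locale tensor_pairs = tensor_product tens
  for tens :: "'h::complex_hilbert \<Rightarrow> 'k::complex_hilbert \<Rightarrow> 'l::complex_hilbert" +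
  fixes e1 e2 :: 'h and k1 k2 :: 'k
  assumes e: "norm e1 = 1" "norm e2 = 1" "cinner e1 e2 = 0"
    and k: "norm k1 = 1" "norm k2 = 1" "cinner k1 k2 = 0"
begin

lemma pair_cinner:
  "cinner e1 e1 = 1" "cinner e2 e2 = 1" "cinner e1 e2 = 0" "cinner e2 e1 = 0"
  "cinner k1 k1 = 1" "cinner k2 k2 = 1" "cinner k1 k2 = 0" "cinner k2 k1 = 0"
  using e k cinner_commute[of e2 e1] cinner_commute[of k2 k1] by (simp_all add: cinner_norm)

definition q :: real where "q = 1 / sqrt 2"
definition V1 :: 'l where "V1 = tens e2 k1"
definition V2 :: 'l where "V2 = q *\<^sub>R (tens e1 k1 + tens e2 k2)"
definition U2 :: 'l where "U2 = - tens e1 k1"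
definition W :: "'l \<Rightarrow>\<^sub>L 'l" where "W = rank_one V1 V1 + rank_one U2 V2"

lemma q: "q * q = 1 / 2" "0 < q" "q < 3 / 4" "2 / 3 < q"
proof -
  show *: "q * q = 1 / 2" "0 < q" by (simp_all add: q_def)
  show "q < 3 / 4" by (rule power2_less_imp_less) (simp_all add: power2_eq_square *)
  show "2 / 3 < q" by (rule power2_less_imp_less) (use * in \<open>simp_all add: power2_eq_square\<close>)
qed

lemma q_complex: "complex_of_real q * (2 * complex_of_real q) = 1"
  using arg_cong[OF q(1), of complex_of_real] by (simp add: mult_ac)

lemma W_apply: "W v = cinner V1 v *\<^sub>C V1 + cinner V2 v *\<^sub>C U2"
  by (simp add: W_def blinfun.add_left rank_one_apply)

lemma frame_cinner:
  "cinner V1 V1 = 1" "cinner V1 V2 = 0" "cinner V2 V1 = 0" "cinner V2 V2 = 1"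
  "cinner U2 U2 = 1" "cinner V1 U2 = 0" "cinner U2 V1 = 0"
  by (simp_all add: V1_def V2_def U2_def cinner_algebra cinner_tens pair_cinner q_complex)

lemma frame_norm: "norm V1 = 1" "norm V2 = 1" "norm U2 = 1"
  using norm_power2_eqI[of V1 1] norm_power2_eqI[of V2 1] norm_power2_eqI[of U2 1]
  by (simp_all add: frame_cinner abs_square_eq_1)

lemma W_bounded_ops: "W \<in> bounded_ops"
  unfolding W_def by (intro bounded_ops_add rank_one_bounded_ops)

text \<open>The functional \<open>of_real q * cinner V1 (X V1) + cinner U2 (X V2)\<close> of
  \<open>X\<close> has norm at most \<open>q + 1\<close> and attains this value at \<open>W\<close>.
  On ampliations its terms are \<open>q * a\<close> and \<open>- q * a\<close>, the sign coming from
  \<open>U2\<close>.\<close>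

lemma infdist_W: "1 \<le> infdist W ampliations"
proof -
  have "1 \<le> norm (W - X)" if X: "X \<in> ampliations" for X
  proof -
    obtain B where B: "\<And>x y. X (tens x y) = tens x (blinfun_apply B y)"
      using X by (auto simp: ampliations_def)
    define a where "a = cinner k1 (B k1)"
    have X1: "cinner V1 (X V1) = a"
      by (simp add: V1_def B cinner_tens pair_cinner a_def)
    have X2: "cinner U2 (X V2) = - of_real q * a"
      by (simp add: U2_def V2_def B cinner_tens pair_cinner a_def cinner_algebra
          blinfun.add_right blinfun.scaleR_right)
    have W1: "cinner V1 (W V1) = 1" "cinner U2 (W V2) = 1"
      by (simp_all add: W_apply frame_cinner cinner_algebra)
    have "of_real q * cinner V1 ((W - X) V1) + cinner U2 ((W - X) V2) = of_real (q + 1)"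
      by (simp add: blinfun.diff_left cinner_diff_right X1 X2 W1 algebra_simps)
    then have "q + 1 = cmod (of_real q * cinner V1 ((W - X) V1) + cinner U2 ((W - X) V2))"
      using q(2) by (simp only: norm_of_real)
    also have "\<dots> \<le> q * cmod (cinner V1 ((W - X) V1)) + cmod (cinner U2 ((W - X) V2))"
      using norm_triangle_ineq[of "of_real q * cinner V1 ((W - X) V1)"] q(2) by (simp add: norm_mult)
    also have "\<dots> \<le> q * norm (W - X) + norm (W - X)"
      using cinner_cauchy_schwarz[of V1 "(W - X) V1"] cinner_cauchy_schwarz[of U2 "(W - X) V2"]
        norm_blinfun[of "W - X" V1] norm_blinfun[of "W - X" V2] q(2)
      by (intro add_mono mult_left_mono) (auto simp: frame_norm)
    also have "\<dots> = (q + 1) * norm (W - X)" by (simp add: distrib_right)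
    finally show ?thesis using q(2) by simp
  qed
  moreover have "ampliations \<noteq> {}" using op_space.subspace_0[OF subspace_ampliations] by blast
  ultimately show ?thesis by (auto simp: infdist_notempty dist_norm intro: cINF_greatest)
qed

lemma ampliation_rank_one:
  assumes "norm (a :: 'k) = 1" "norm b = 1"
  obtains X where "X \<in> ampliations" "norm X \<le> 1"
    "\<And>x y. blinfun_apply X (tens x y) = cinner b y *\<^sub>C tens x a"
proof -
  obtain X where X: "X \<in> bounded_ops" "\<And>x y. blinfun_apply X (tens x y) = tens x (rank_one a b y)"
      "norm X \<le> norm (rank_one a b)"
    using ampliation_exists[OF rank_one_bounded_ops[of a b]] by blast
  then have "X \<in> ampliations" unfolding ampliations_def using rank_one_bounded_ops by blast
  moreover have "norm X \<le> 1" using X(3) norm_rank_one[of a b] assms by simp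
  ultimately show ?thesis using that X(2) by (simp add: rank_one_apply tens_scaleC_right)
qed

text \<open>A coefficient near 1 forces \<open>v\<close> to be near its projection \<open>v'\<close>
  onto the initial space and \<open>u\<close> near a multiple of \<open>W v\<close>. Then
  \<open>W v\<close> is almost orthogonal to \<open>X v'\<close> for every contraction
  \<open>X\<close> in the algebra. Two choices of \<open>X\<close> make both
  \<open>a - q * b\<close> and \<open>a * b\<close> small although \<open>a + b\<close> is near 1, a
  contradiction.\<close>

lemma beta_W: "beta ampliations W \<le> 999 / 1000"
proof (rule beta_le[OF subspace_ampliations frame_norm(1)])
  fix u v :: 'l assume uv: "norm u = 1" "norm v = 1" and orth: "\<And>A. A \<in> ampliations \<Longrightarrow> cinner u (A v) = 0"
  show "cmod (cinner u (W v)) \<le> 999 / 1000"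
  proof (rule ccontr)
    define \<rho> where "\<rho> = cmod (cinner u (W v))"
    assume "\<not> ?thesis"
    then have \<rho>: "\<rho> > 999 / 1000" by (simp add: \<rho>_def)
    define s t where "s = cinner V1 v" and "t = cinner V2 v"
    define r where "r = (cmod s)\<^sup>2 + (cmod t)\<^sup>2"
    define v' where "v' = s *\<^sub>C V1 + t *\<^sub>C V2"
    have W: "W v = s *\<^sub>C V1 + t *\<^sub>C U2" by (simp add: W_apply s_def t_def)
    have nW: "(norm (W v))\<^sup>2 = r"
      unfolding W r_def by (simp add: norm_add_power2 norm_scaleC frame_norm frame_cinner cinner_algebra)
    have nv': "(norm v')\<^sup>2 = r"
      unfolding v'_def r_def by (simp add: norm_add_power2 norm_scaleC frame_norm frame_cinner cinner_algebra)
    have "cinner v' v = of_real r"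
      unfolding v'_def r_def
      by (simp add: cinner_algebra complex_norm_square mult.commute flip: s_def t_def
          del: of_real_power)
    then have vv': "(norm (v' - v))\<^sup>2 = 1 - r"
      using uv by (simp add: norm_diff_power2 nv')
    then have "r \<le> 1" using zero_le_power2[of "norm (v' - v)"] by linarith
    have "\<rho> \<le> norm (W v)" using cinner_cauchy_schwarz[of u "W v"] uv by (simp add: \<rho>_def)
    then have "\<rho>\<^sup>2 \<le> r" using \<rho> unfolding nW[symmetric] by (intro power_mono) auto
    moreover have "(999 / 1000)\<^sup>2 \<le> \<rho>\<^sup>2" using \<rho> by (intro power_mono) auto
    ultimately have r: "998 / 1000 \<le> r" by (simp add: power2_eq_square)
    obtain c where c: "cmod c = 1" "cinner u (c *\<^sub>C W v) = of_real \<rho>"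
      using cinner_rotate[of u "W v"] unfolding \<rho>_def by blast
    define w where "w = c *\<^sub>C W v"
    have "(norm (w - u))\<^sup>2 = r + 1 - 2 * \<rho>"
      using c uv nW unfolding norm_minus_commute[of w] by (simp add: norm_diff_power2 w_def norm_scaleC)
    \<comment> \<open>Both \<open>r + 1 - 2 * \<rho>\<close> and \<open>1 - r\<close> are at most
      \<open>2 / 1000\<close>, just below \<open>(45 / 1000)\<^sup>2\<close>; the two errors add up
      to \<open>9 / 100\<close>.\<close>
    then have "(norm (w - u))\<^sup>2 \<le> (45 / 1000)\<^sup>2" using \<open>r \<le> 1\<close> \<rho> by (simp add: power2_eq_square)
    then have wu: "norm (w - u) \<le> 45 / 1000" by (rule power2_le_imp_le) simp
    have "(norm (v' - v))\<^sup>2 \<le> (45 / 1000)\<^sup>2" using r vv' by (simp add: power2_eq_square)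
    then have v'v: "norm (v' - v) \<le> 45 / 1000" by (rule power2_le_imp_le) simp
    have "(norm v')\<^sup>2 \<le> 1\<^sup>2" using nv' \<open>r \<le> 1\<close> by simp
    then have nv'1: "norm v' \<le> 1" by (rule power2_le_imp_le) simp
    have small: "cmod (cinner (W v) (X v')) \<le> 9 / 100" if X: "X \<in> ampliations" "norm X \<le> 1" for X
    proof -
      have le: "norm (X x) \<le> norm x" for x
        using norm_blinfun[of X x] mult_right_mono[OF X(2) norm_ge_zero[of x]] by simp
      have "cmod (cinner (W v) (X v')) = cmod (cinner w (X v'))"
        by (simp add: w_def cinner_scaleC_left norm_mult c)
      also have "cinner w (X v') = cinner (w - u) (X v') + cinner u (X (v' - v))"
        using orth[OF X(1)] by (simp add: cinner_algebra blinfun.diff_right)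
      also have "cmod \<dots> \<le> cmod (cinner (w - u) (X v')) + cmod (cinner u (X (v' - v)))"
        by (rule norm_triangle_ineq)
      also have "\<dots> \<le> norm (w - u) * norm (X v') + norm u * norm (X (v' - v))"
        by (intro add_mono cinner_cauchy_schwarz)
      also have "\<dots> \<le> 45 / 1000 * 1 + 1 * (45 / 1000)"
        using wu v'v nv'1 le[of v'] le[of "v' - v"] uv by (intro add_mono mult_mono) auto
      finally show ?thesis by simp
    qed
    define a b where "a = (cmod s)\<^sup>2" and "b = (cmod t)\<^sup>2"
    obtain X1 where X1: "X1 \<in> ampliations" "norm X1 \<le> 1"
        "\<And>x y. blinfun_apply X1 (tens x y) = cinner k1 y *\<^sub>C tens x k1"
      by (rule ampliation_rank_one[OF k(1) k(1)], rule that)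
    have "cinner (W v) (X1 v') = cnj s * s - of_real q * (cnj t * t)"
      unfolding W v'_def V1_def V2_def U2_def
      by (simp add: cinner_algebra cinner_tens pair_cinner blinfun.add_right blinfun.scaleR_right
          bounded_ops_scaleC X1(1)[unfolded ampliations_def, THEN CollectD, THEN conjunct1] X1(3))
    also have "\<dots> = of_real (a - q * b)"
      using complex_norm_square[of s] complex_norm_square[of t] by (simp add: a_def b_def mult.commute)
    finally have ab1: "\<bar>a - q * b\<bar> \<le> 9 / 100" using small[OF X1(1,2)] by (simp only: norm_of_real)
    obtain X2 where X2: "X2 \<in> ampliations" "norm X2 \<le> 1"
        "\<And>x y. blinfun_apply X2 (tens x y) = cinner k2 y *\<^sub>C tens x k1"
      by (rule ampliation_rank_one[OF k(1) k(2)], rule that)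
    have "cinner (W v) (X2 v') = of_real q * (cnj s * t)"
      unfolding W v'_def V1_def V2_def U2_def
      by (simp add: cinner_algebra cinner_tens pair_cinner blinfun.add_right blinfun.scaleR_right
          bounded_ops_scaleC X2(1)[unfolded ampliations_def, THEN CollectD, THEN conjunct1] X2(3))
    then have "q * (cmod s * cmod t) \<le> 9 / 100"
      using small[OF X2(1,2)] q(2) by (simp add: norm_mult)
    then have "(q * (cmod s * cmod t))\<^sup>2 \<le> (9 / 100)\<^sup>2" using q(2) by (intro power_mono) auto
    \<comment> \<open>The bound is \<open>2 * (9 / 100)\<^sup>2\<close>, as
      \<open>q * q = 1 / 2\<close>.\<close>
    then have ab2: "a * b \<le> 162 / 10000"
      using q(1) by (simp add: power_mult_distrib a_def b_def power2_eq_square[of q] power2_eq_square[of "9/100"])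
    have ab: "0 \<le> a" "0 \<le> b" "998 / 1000 \<le> a + b" using r by (simp_all add: a_def b_def r_def)
    have qb: "2 / 3 * b \<le> q * b" "q * b \<le> b"
      using q mult_right_mono[of "2/3" q b] mult_right_mono[of q 1 b] ab by simp_all
    show False
    \<comment> \<open>The larger weight is at least \<open>499 / 1000\<close>, which makes the
      smaller one tiny and forces \<open>a - q * b\<close> beyond \<open>1 / 2\<close> in
      modulus.\<close>
    proof (cases "a \<le> b")
      case True
      then have "a * (499 / 1000) \<le> a * b" using ab by (intro mult_left_mono) auto
      then show False using ab1 ab2 qb ab by linarith
    next
      case False
      then have "(499 / 1000) * b \<le> a * b" using ab by (intro mult_right_mono) auto
      then show False using ab1 ab2 qb ab by linarith
    qed
  qed
qed simp

end

theorem corollary6p7: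
  fixes tens :: "'h::complex_hilbert \<Rightarrow> 'k::complex_hilbert \<Rightarrow> 'l::complex_hilbert"
  assumes dim_H: "\<exists>B :: 'h set. complex_space.independent B \<and> card B = 2"
    and K: "separable_infinite_dim TYPE('k)"
    and tens: "hilbert_tensor tens"
  shows "completely_hyperreflexive tens (scalar_ops :: ('h \<Rightarrow>\<^sub>L 'h) set)
    \<and> hyperreflexive (scalar_ops :: ('h \<Rightarrow>\<^sub>L 'h) set)
    \<and> 1 = kappa (scalar_ops :: ('h \<Rightarrow>\<^sub>L 'h) set)
    \<and> kappa (scalar_ops :: ('h \<Rightarrow>\<^sub>L 'h) set) < kappa_c tens (scalar_ops :: ('h \<Rightarrow>\<^sub>L 'h) set)"
proof -
  obtain e1 e2 :: 'h where e: "norm e1 = 1" "norm e2 = 1" "cinner e1 e2 = 0"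
  proof -
    obtain B :: "'h set" where B: "complex_space.independent B" "card B = 2" using dim_H by blast
    then obtain x y where xy: "B = {x, y}" "x \<noteq> y" by (auto simp: card_2_iff)
    have "x \<noteq> 0" using B(1) complex_space.dependent_zero[of B] xy by auto
    moreover have "y \<notin> complex_space.span {x}"
    proof
      assume "y \<in> complex_space.span {x}"
      moreover have "B - {y} = {x}" using xy by auto
      ultimately show False using B(1) xy(1) unfolding complex_space.dependent_def by auto
    qed
    ultimately show ?thesis using orthonormal_pair_exists that by blast
  qed
  obtain k1 k2 :: 'k where k: "norm k1 = 1" "norm k2 = 1" "cinner k1 k2 = 0"
  proof -
    have nspan: "complex_space.span B \<noteq> UNIV" if "finite B" for B :: "'k set"
      using K that unfolding separable_infinite_dim_def by blast
    have "\<exists>x :: 'k. x \<noteq> 0" using nspan[of "{}"] by auto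
    then obtain x :: 'k where "x \<noteq> 0" by blast
    moreover obtain y where "y \<notin> complex_space.span {x}" using nspan[of "{x}"] by blast
    ultimately show ?thesis using orthonormal_pair_exists that by blast
  qed
  interpret tensor_pairs tens e1 e2 k1 k2 by unfold_locales (fact tens e k)+
  let ?S = "scalar_ops :: ('h \<Rightarrow>\<^sub>L 'h) set"
  have wot: "wot_tensor tens ?S bounded_ops = ampliations" by (rule wot_tensor_scalar_ops[OF e(1)])
  have hyp4: "hyperreflexive_with ampliations 4"
    by (rule hyperreflexive_with_ampliations[OF e(1) frame_norm(1)])
  have complete: "completely_hyperreflexive tens ?S"
    unfolding completely_hyperreflexive_def op_subspace_def hyperreflexive_def wot
    using subspace_scalar_ops closedin_wot_scalar_ops[OF e(1)] hyp4 scalar_op_bounded_ops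
    by (auto simp: scalar_ops_def)
  have hyp1: "hyperreflexive_with ?S 1"
    unfolding hyperreflexive_with_def
  proof
    fix T :: "'h \<Rightarrow>\<^sub>L 'h" assume T: "T \<in> bounded_ops"
    have "cmod (cinner u (T v)) \<le> beta ?S T * norm u * norm v" if "cinner u v = 0" for u v
      by (rule cinner_le_beta[OF subspace_scalar_ops])
        (use that in \<open>auto simp: scalar_ops_def scalar_op_apply cinner_scaleC_right\<close>)
    then obtain l where "norm (T - op_scaleC l id_blinfun) \<le> beta ?S T"
      using stampfli_distance_formula[OF T e(1) beta_nonneg[OF subspace_scalar_ops e(1)]] by blast
    moreover have "op_scaleC l id_blinfun \<in> ?S" by (auto simp: scalar_ops_def)
    ultimately show "infdist T ?S \<le> 1 * beta ?S T"
      using infdist_le[of "op_scaleC l id_blinfun" ?S T] by (simp add: dist_norm)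
  qed
  have "1 \<le> C" if "hyperreflexive_with ?S C" for C
  proof -
    \<comment> \<open>Any operator with positive \<beta> would do, because \<beta> never exceeds the
      distance. This one uses the second dimension of H.\<close>
    define R where "R = rank_one e2 e1"
    have "cmod (cinner e2 (R e1)) \<le> beta ?S R * norm e2 * norm e1"
      by (rule cinner_le_beta[OF subspace_scalar_ops])
        (auto simp: scalar_ops_def scalar_op_apply cinner_scaleC_right pair_cinner)
    then have pos: "1 \<le> beta ?S R"
      by (simp add: R_def rank_one_apply cinner_scaleC_right pair_cinner e)
    have "beta ?S R \<le> infdist R ?S" by (rule beta_le_infdist[OF subspace_scalar_ops e(1)])
    also have "\<dots> \<le> C * beta ?S R"
      using that rank_one_bounded_ops unfolding hyperreflexive_with_def R_def by blast
    finally show ?thesis using pos by simp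
  qed
  then have kappa: "kappa ?S = 1"
    unfolding kappa_def using hyp1 by (intro cInf_eq_minimum) auto
  have lower: "1000 / 999 \<le> C" if "0 \<le> C" "hyperreflexive_with ampliations C" for C
  proof -
    have "1 \<le> infdist W ampliations" by (rule infdist_W)
    also have "\<dots> \<le> C * beta ampliations W"
      using that(2) W_bounded_ops unfolding hyperreflexive_with_def by blast
    also have "\<dots> \<le> C * (999 / 1000)" using that(1) beta_W by (rule mult_left_mono[rotated])
    finally show ?thesis by simp
  qed
  \<comment> \<open>The constant 4 also serves here: it shows that the set of admissible constants
    is non-empty, as a lower bound for its infimum requires.\<close>
  have "1000 / 999 \<le> kappa_c tens ?S"
    unfolding kappa_c_def wot kappa_def
    by (rule cInf_greatest) (use hyp4 lower in \<open>auto intro: exI[of _ 4]\<close>)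
  then show ?thesis
    using complete hyp1 kappa unfolding hyperreflexive_def by auto
qed

end
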